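(* Let $\mathbb{F}_q$ be a finite field, let $k \ge 1$, and let $L(x_1, \dots, x_k) = a_1 x_1 + \cdots + a_k x_k$ be a linear form with $a_1, \dots, a_k \in \mathbb{F}_q \setminus\{0\}$. (a) If $a_1, \dots, a_k$ can be partitioned into pairs each summing to zero, then the equation $L = 0$ is Sidorenko and common. (b) If $k$ is even and $a_1, \dots, a_k$ cannot be partitioned into pairs each summing to zero, then the equation $L = 0$ is not common and not Sidorenko. (c) If $k$ is odd, then the equation $L = 0$ is common but not Sidorenko.
   Context: Here $q$ is a prime power and $\mathbb{F}_q$ is the finite field with $q$ elements. A linear form $L(x_1,\dots,x_k) = a_1x_1+\cdots+a_kx_k$ with $a_1,\dots,a_k \in \mathbb{F}_q$ is evaluated on tuples $(x_1,\dots,x_k) \in (\mathbb{F}_q^n)^k$ of vectors, for any positive integer $n$. Solutions are ordered tuples, and coordinates may coincide. The equation $L=0$ is *Sidorenko* if for every $n$ and every $A \subseteq \mathbb{F}_q^n$, the number of solutions to $L(x_1,\dots,x_k)=0$ with $x_1,\dots,x_k \in A$ is at least $|A|^k/q^n$. The equation $L=0$ is *common* if for every $n$ and every coloring of $\mathbb{F}_q^n$ with two colors, the number of monochromatic solutions $(x_1,\dots,x_k) \in (\mathbb{F}_q^n)^k$ to $L(x_1,\dots,x_k)=0$ (i.e. solutions with all $x_i$ of the same color) is at least $2^{1-k} q^{n(k-1)}$. "$a_1,\dots,a_k$ can be partitioned into pairs each summing to zero" means that the index set $\{1,\dots,k\}$ can be partitioned into two-element sets $\{i,j\}$ (with $i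 \neq j$) such that $a_i + a_j = 0$ in $\mathbb{F}_q$ for each of them (in particular, $k$ is even). *)

theory Defs
  imports Complex_Main "HOL-Library.FuncSet" "HOL-Library.Disjoint_Sets" "HOL-Library.Cardinality"
    "Jordan_Normal_Form.Matrix"
begin

text \<open>
  The field \<open>\<bbbF>\<^sub>q\<close> is a type \<open>'a :: {field, finite}\<close>, so \<open>q = CARD('a)\<close>, and the space of
  \<open>n\<close>-dimensional vectors over it is \<^term>\<open>carrier_vec n\<close>. The coefficients are \<open>a 1, \<dots>, a k\<close>;
  the other values of \<open>a\<close> are irrelevant. A \<open>k\<close>-tuple over a set \<open>A\<close> is an element of
  \<open>{1..k} \<rightarrow>\<^sub>E A\<close>, i.e. it is \<^term>\<open>undefined\<close> outside \<open>{1..k}\<close>, so that tuples can be counted.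
\<close>

definition linear_form ::
    "nat \<Rightarrow> nat \<Rightarrow> (nat \<Rightarrow> 'a::field) \<Rightarrow> (nat \<Rightarrow> 'a vec) \<Rightarrow> 'a vec" where
  "linear_form n k a x = finsum_vec TYPE('a) n (\<lambda>i. a i \<cdot>\<^sub>v x i) {1..k}"

definition solutions ::
    "nat \<Rightarrow> nat \<Rightarrow> (nat \<Rightarrow> 'a::field) \<Rightarrow> 'a vec set \<Rightarrow> (nat \<Rightarrow> 'a vec) set" where
  "solutions n k a A = {x \<in> {1..k} \<rightarrow>\<^sub>E A. linear_form n k a x = 0\<^sub>v n}"

definition sidorenko :: "nat \<Rightarrow> (nat \<Rightarrow> 'a::{field,finite}) \<Rightarrow> bool" where
  "sidorenko k a \<longleftrightarrow>
     (\<forall>n\<ge>1. \<forall>A \<subseteq> carrier_vec n.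
        real (card (solutions n k a A)) \<ge> real (card A) ^ k / real CARD('a) ^ n)"

definition monochromatic_solutions ::
    "nat \<Rightarrow> nat \<Rightarrow> (nat \<Rightarrow> 'a::field) \<Rightarrow> ('a vec \<Rightarrow> bool) \<Rightarrow> (nat \<Rightarrow> 'a vec) set" where
  "monochromatic_solutions n k a c =
     {x \<in> solutions n k a (carrier_vec n). \<forall>i\<in>{1..k}. \<forall>j\<in>{1..k}. c (x i) = c (x j)}"

text \<open>
  A colouring with two colours is a function to \<^typ>\<open>bool\<close>. The exponent \<open>1 - k\<close> of \<open>2\<close> is an
  integer; the exponent \<open>n * (k - 1)\<close> is a natural number, with no truncation for \<open>k \<ge> 1\<close>.
\<close>

definition common :: "nat \<Rightarrow> (nat \<Rightarrow> 'a::{field,finite}) \<Rightarrow> bool" where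
  "common k a \<longleftrightarrow>
     (\<forall>n\<ge>1. \<forall>c :: 'a vec \<Rightarrow> bool.
        real (card (monochromatic_solutions n k a c))
          \<ge> 2 powi (1 - int k) * real CARD('a) ^ (n * (k - 1)))"

definition zero_sum_pairing :: "nat \<Rightarrow> (nat \<Rightarrow> 'a::field) \<Rightarrow> bool" where
  "zero_sum_pairing k a \<longleftrightarrow>
     (\<exists>P. partition_on {1..k} P \<and> (\<forall>B\<in>P. \<exists>i j. i \<noteq> j \<and> B = {i, j} \<and> a i + a j = 0))"

end

theory Submission
  imports Defs "Berlekamp_Zassenhaus.Berlekamp_Type_Based"
begin

text \<open>
  Fix a nontrivial additive character of the field, and write \<open>F^\<close> for the resulting Fourier transform
  of a function \<open>F\<close> on \<open>V = \<bbbF>\<^sub>q\<^sup>n\<close>. Detecting the condition \<open>L = 0\<close> by orthogonality of characters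
  (\<open>sum_over_solutions\<close>) shows that \<open>q\<^sup>n\<close> times the sum of \<open>F(x\<^sub>1) \<cdots> F(x\<^sub>k)\<close> over all solutions equals
  the sum of \<open>F^(a\<^sub>1 r) \<cdots> F^(a\<^sub>k r)\<close> over all \<open>r \<in> V\<close>. For the indicator of a set \<open>A\<close> the term
  \<open>r = 0\<close> is \<open>|A|\<^sup>k\<close>, so everything depends on the sign of the remaining terms.

  If the coefficients pair up as \<open>a\<^sub>i = - a\<^sub>j\<close>, each pair contributes a squared modulus
  \<open>|F^(a\<^sub>i r)|\<^sup>2\<close>. All terms are then nonnegative, and the equation is Sidorenko. A Sidorenko equation
  is common: add the Sidorenko bounds of both colour classes and use convexity of \<open>t \<mapsto> t\<^sup>k\<close>.

  Away from \<open>0\<close>, the transform of the indicator of the complement of \<open>A\<close> is minus that of \<open>A\<close>. For odd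
  \<open>k\<close> the terms with \<open>r \<noteq> 0\<close> therefore cancel when the counts for \<open>A\<close> and its complement are added
  (\<open>odd_complement_identity\<close>), and the sum depends on \<open>|A|\<close> only. Commonness follows by convexity.
  Since \<open>{0}\<close> has more solutions than its density predicts, its complement has fewer, and the
  equation is not Sidorenko.

  For even \<open>k\<close> without a pairing, the aim is a function \<open>f = 1/2 + g\<close> with values in \<open>[0, 1]\<close> whose
  terms with \<open>r \<noteq> 0\<close> have a negative sum. The transform of \<open>g\<close> is supported on a line, where its
  values are proportional to phases \<open>s(b)\<close> of modulus \<open>1\<close> with \<open>s(-b)\<close> conjugate to \<open>s(b)\<close>. On the
  finite group of such \<open>s\<close> with values in the \<open>2k\<close>-th roots of unity, each map
  \<open>s \<mapsto> s(a\<^sub>1 r) \<cdots> s(a\<^sub>k r)\<close> with \<open>r \<noteq> 0\<close> is a character, which is nontrivial because the \<open>a\<^sub>i\<close> do not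
  pair up (\<open>pairing_if_phases_trivial\<close>). So its average is \<open>0\<close>. As \<open>s = 1\<close> makes the sum over
  \<open>r \<noteq> 0\<close> positive, some other \<open>s\<close> makes it negative (\<open>negative_phases_exist\<close>). Because \<open>k\<close> is
  even, \<open>f\<close> and \<open>1 - f\<close> lose equally, by a proportion independent of \<open>n\<close>
  (\<open>negative_fractional_colouring\<close>).

  It remains to replace \<open>f\<close> by a colouring. The weight of the solutions with distinct entries is affine
  in each value of \<open>f\<close> separately, so the values can be rounded one by one to \<open>0\<close> or \<open>1\<close> without
  increasing it (\<open>round_solutions\<close>). The solutions with a repeated entry number at most
  \<open>k\<^sup>2 (q\<^sup>n) ^ (k - 2)\<close>, which for large \<open>n\<close> is less than what has been gained.
\<close>

section \<open>A nontrivial additive character of a finite field\<close>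

text \<open>
  A maximal proper additive subgroup \<open>H\<close> has index equal to the characteristic \<open>p\<close>: any \<open>x \<notin> H\<close>
  generates the whole field together with \<open>H\<close>, and a multiple of \<open>x\<close> lies in \<open>H\<close> only if the factor is
  divisible by \<open>p\<close>. Sending \<open>h + j x\<close> to the \<open>j\<close>-th power of a primitive \<open>p\<close>-th root of unity
  is then a well-defined character.
\<close>

lemma nontrivial_additive_character_exists:
  "\<exists>\<psi> :: 'a::{field,finite} \<Rightarrow> complex.
     (\<forall>x y. \<psi> (x + y) = \<psi> x * \<psi> y) \<and> (\<forall>x. norm (\<psi> x) = 1) \<and> (\<exists>x. \<psi> x \<noteq> 1)"
proof -
  define p where "p = CHAR('a)"
  have p: "prime p"
    unfolding p_def by (rule prime_CHAR_semidom, rule finite_imp_CHAR_pos, rule finite)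
  define sub :: "'a set \<Rightarrow> bool" where
    "sub H \<longleftrightarrow> 0 \<in> H \<and> (\<forall>x\<in>H. \<forall>y\<in>H. x + y \<in> H) \<and> (\<forall>x\<in>H. - x \<in> H)" for H
  have multiples: "of_int j * h \<in> H" if "sub H" "h \<in> H" for H j h
  proof -
    have nat: "of_nat m * h \<in> H" for m
      by (induction m) (use that in \<open>auto simp: sub_def algebra_simps\<close>)
    show ?thesis
    proof (cases j)
      case (nonneg m)
      then show ?thesis using nat[of m] by simp
    next
      case (neg m)
      then have "of_int j * h = - (of_nat (Suc m) * h)"
        by (simp only: of_int_minus of_int_of_nat_eq minus_mult_left)
      then show ?thesis using nat[of "Suc m"] that by (metis sub_def)
    qed
  qed
  have "sub {0}" by (simp add: sub_def)
  moreover have "{0} \<noteq> (UNIV :: 'a set)"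
    by (metis UNIV_I singletonD zero_neq_one)
  ultimately have "{H. sub H \<and> H \<noteq> UNIV} \<noteq> {}" by blast
  then obtain H where H: "sub H" "H \<noteq> UNIV"
    and maximal: "\<And>K. sub K \<Longrightarrow> K \<noteq> UNIV \<Longrightarrow> H \<subseteq> K \<Longrightarrow> H = K"
    using finite_has_maximal[of "{H. sub H \<and> H \<noteq> UNIV}"] by auto
  obtain x where x: "x \<notin> H" using H(2) by blast
  have dvd: "int p dvd j" if j: "of_int j * x \<in> H" for j
  proof (rule ccontr)
    assume "\<not> int p dvd j"
    then have "coprime (int p) j"
      using p by (simp add: prime_imp_coprime)
    \<comment> \<open>A factor invertible modulo \<open>p\<close> would let \<open>x\<close> itself be recovered inside \<open>H\<close>.\<close>
    then obtain u v where uv: "u * int p + v * j = 1"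
      using bezout_int[of "int p" j] by auto
    have "of_nat p = (0 :: 'a)"
      by (simp add: p_def)
    then have "x = of_int v * (of_int j * x)"
      using arg_cong[OF uv, of "\<lambda>z. of_int z * x"] by (simp add: mult.assoc)
    then show False
      using multiples[OF H(1) j, of v] x by metis
  qed
  define K where "K = {y. \<exists>j. y - of_int j * x \<in> H}"
  have "sub K"
    unfolding sub_def
  proof (intro conjI ballI)
    show "0 \<in> K"
      unfolding K_def using H(1) by (auto simp: sub_def intro!: exI[of _ 0])
  next
    fix y z assume "y \<in> K" "z \<in> K"
    then obtain i j where "y - of_int i * x \<in> H" "z - of_int j * x \<in> H"
      unfolding K_def by auto
    then have "(y - of_int i * x) + (z - of_int j * x) \<in> H"
      using H(1) by (auto simp: sub_def)
    then have "y + z - of_int (i + j) * x \<in> H"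
      by (simp add: algebra_simps)
    then show "y + z \<in> K" unfolding K_def by blast
  next
    fix y assume "y \<in> K"
    then obtain i where "y - of_int i * x \<in> H"
      unfolding K_def by auto
    then have "- (y - of_int i * x) \<in> H"
      using H(1) by (auto simp: sub_def)
    then have "- y - of_int (- i) * x \<in> H"
      by (simp add: algebra_simps)
    then show "- y \<in> K" unfolding K_def by blast
  qed
  moreover have "H \<subseteq> K"
    unfolding K_def by (auto intro!: exI[of _ 0])
  moreover have "x \<in> K"
    unfolding K_def using H(1) by (auto simp: sub_def intro!: exI[of _ 1])
  ultimately have "K = UNIV"
    using maximal x by blast
  then have "\<forall>y. \<exists>j. y - of_int j * x \<in> H"
    unfolding K_def by blast
  then obtain J where J: "\<And>y. y - of_int (J y) * x \<in> H"
    by metis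
  define \<psi> where "\<psi> y = cis (2 * pi * (of_int (J y) / p))" for y
  have p0: "p > 0" using p by (simp add: prime_gt_0_nat)
  have "\<psi> (y + z) = \<psi> y * \<psi> z" for y z
  proof -
    \<comment> \<open>The representative \<open>J\<close> is chosen arbitrarily, so it is additive only modulo \<open>p\<close>.\<close>
    let ?d = "J (y + z) - J y - J z"
    have "(y - of_int (J y) * x) + (z - of_int (J z) * x) + - (y + z - of_int (J (y + z)) * x) \<in> H"
      using J[of y] J[of z] J[of "y + z"] H(1) unfolding sub_def by blast
    then have "of_int ?d * x \<in> H"
      by (simp add: algebra_simps)
    then obtain m where m: "?d = int p * m" using dvd by blast
    have "2 * pi * (of_int (J (y + z)) / p)
        = 2 * pi * (of_int (J y) / p) + 2 * pi * (of_int (J z) / p) + 2 * pi * of_int m"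
      using arg_cong[OF m, of real_of_int] p0 by (simp add: field_simps)
    then show ?thesis
      unfolding \<psi>_def by (simp add: cis_mult[symmetric])
  qed
  moreover have "norm (\<psi> y) = 1" for y
    unfolding \<psi>_def by simp
  moreover have "\<psi> x \<noteq> 1"
  proof
    assume "\<psi> x = 1"
    then have "cos (2 * pi * (of_int (J x) / p)) = 1"
      unfolding \<psi>_def by (simp add: complex_eq_iff)
    then obtain m :: int where "2 * pi * (of_int (J x) / p) = of_int m * 2 * pi"
      by (auto simp: cos_one_2pi_int)
    then have "real_of_int (J x) = of_int m * p"
      using p0 by (simp add: field_simps)
    then have "real_of_int (J x) = real_of_int (m * int p)"
      by simp
    then have "int p dvd J x"
      by (simp only: of_int_eq_iff) simp
    moreover have "int p dvd 1 - J x"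
      using J[of x] by (intro dvd) (simp add: algebra_simps)
    ultimately have "int p dvd J x + (1 - J x)" by (rule dvd_add)
    then show False using p by (simp add: prime_nat_iff)
  qed
  ultimately show ?thesis by blast
qed

section \<open>Fourier expansion of solution counts\<close>

locale additive_character =
  fixes \<psi> :: "'a::{field,finite} \<Rightarrow> complex"
  assumes map_add: "\<psi> (x + y) = \<psi> x * \<psi> y"
    and norm_eq_1: "norm (\<psi> x) = 1"
    and nontrivial: "\<exists>x. \<psi> x \<noteq> 1"
begin

lemma map_zero: "\<psi> 0 = 1"
proof -
  have "\<psi> 0 \<noteq> 0" using norm_eq_1[of 0] by auto
  then show ?thesis using map_add[of 0 0] by simp
qed

lemma map_uminus: "\<psi> (- x) = cnj (\<psi> x)"
proof -
  have "\<psi> x * \<psi> (- x) = \<psi> x * cnj (\<psi> x)"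
    using map_add[of x "- x"] norm_eq_1[of x] by (simp add: map_zero complex_norm_square[symmetric])
  moreover have "\<psi> x \<noteq> 0" using norm_eq_1[of x] by auto
  ultimately show ?thesis by simp
qed

lemma map_sum: "\<psi> (sum f I) = (\<Prod>i\<in>I. \<psi> (f i))"
  by (induction I rule: infinite_finite_induct) (auto simp: map_zero map_add)

text \<open>
  If \<open>r \<noteq> 0\<close>, some \<open>w\<close> has \<open>\<psi>(r \<bullet> w) \<noteq> 1\<close>. Translating the sum by \<open>w\<close> multiplies it by this value, so
  the sum vanishes.
\<close>

lemma orthogonality:
  assumes r: "r \<in> carrier_vec n"
  shows "(\<Sum>v\<in>carrier_vec n. \<psi> (r \<bullet> v)) = (if r = 0\<^sub>v n then of_nat (CARD('a) ^ n) else 0)"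
proof (cases "r = 0\<^sub>v n")
  case True
  then have "(\<Sum>v\<in>carrier_vec n. \<psi> (r \<bullet> v)) = (\<Sum>v\<in>(carrier_vec n :: 'a vec set). 1)"
    by (intro sum.cong) (auto simp: map_zero)
  then show ?thesis using True by (simp add: card_carrier_vec)
next
  case False
  then obtain i where i: "i < n" "r $ i \<noteq> 0"
    using r by (metis carrier_vecD eq_vecI index_zero_vec)
  obtain x where x: "\<psi> x \<noteq> 1" using nontrivial by blast
  define w where "w = (x / r $ i) \<cdot>\<^sub>v unit_vec n i"
  have w: "w \<in> carrier_vec n" by (simp add: w_def)
  have rw: "r \<bullet> w = x" using r i by (simp add: w_def)
  have cancel: "v + w - w = v" "v - w + w = v" if "v \<in> carrier_vec n" for v
    using that w by (auto intro!: eq_vecI)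
  let ?S = "\<Sum>v\<in>carrier_vec n. \<psi> (r \<bullet> v)"
  have "?S = (\<Sum>v\<in>carrier_vec n. \<psi> (r \<bullet> (v + w)))"
    using w by (intro sum.reindex_bij_witness[of _ "\<lambda>v. v + w" "\<lambda>v. v - w"])
      (auto simp: cancel)
  also have "\<dots> = \<psi> x * ?S"
    using r w rw by (simp add: scalar_prod_add_distrib[OF r _ w] map_add sum_distrib_left mult.commute)
  finally have "(1 - \<psi> x) * ?S = 0" by (simp add: algebra_simps)
  then show ?thesis using x False by simp
qed

definition fourier :: "nat \<Rightarrow> ('a vec \<Rightarrow> complex) \<Rightarrow> 'a vec \<Rightarrow> complex" where
  "fourier n F r = (\<Sum>v\<in>carrier_vec n. F v * \<psi> (r \<bullet> v))"

lemma fourier_zero: "fourier n F (0\<^sub>v n) = (\<Sum>v\<in>carrier_vec n. F v)"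
  unfolding fourier_def by (intro sum.cong) (auto simp: map_zero)

lemma fourier_opposite:
  assumes "\<And>v. cnj (F v) = F v" "b + c = 0" "r \<in> carrier_vec n"
  shows "fourier n F (c \<cdot>\<^sub>v r) = cnj (fourier n F (b \<cdot>\<^sub>v r))"
proof -
  have c: "c = - b" using assms(2) by (simp add: eq_neg_iff_add_eq_0 add.commute)
  show ?thesis
    using assms(1,3) unfolding fourier_def c cnj_sum
    by (intro sum.cong) (auto simp: map_uminus[symmetric])
qed

text \<open>
  The condition \<open>L(x) = 0\<close> is replaced by the average of \<open>\<psi>(r \<bullet> L(x))\<close> over \<open>r\<close>. Since
  \<open>r \<bullet> L(x)\<close> is the sum of the \<open>(a\<^sub>i r) \<bullet> x\<^sub>i\<close>, the sum over all tuples factors into Fourier transforms.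
\<close>

theorem sum_over_solutions:
  "of_nat (CARD('a) ^ n) * (\<Sum>x\<in>solutions n k a (carrier_vec n). \<Prod>i\<in>{1..k}. F (x i))
     = (\<Sum>r\<in>carrier_vec n. \<Prod>i\<in>{1..k}. fourier n F (a i \<cdot>\<^sub>v r))"
proof -
  let ?V = "carrier_vec n :: 'a vec set"
  let ?T = "{1..k} \<rightarrow>\<^sub>E ?V"
  have char: "(\<Prod>i\<in>{1..k}. \<psi> ((a i \<cdot>\<^sub>v r) \<bullet> x i)) = \<psi> (linear_form n k a x \<bullet> r)"
    if r: "r \<in> ?V" and x: "x \<in> ?T" for r x
  proof -
    have xi: "x i \<in> ?V" if "i \<in> {1..k}" for i using x that by auto
    have "linear_form n k a x \<bullet> r = (\<Sum>j<n. (\<Sum>i\<in>{1..k}. a i * x i $ j) * r $ j)"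
    proof -
      have "linear_form n k a x $ j = (\<Sum>i\<in>{1..k}. a i * x i $ j)" if "j < n" for j
        unfolding linear_form_def using xi that
        by (subst index_finsum_vec) (auto intro!: sum.cong index_smult_vec simp: carrier_vecD[OF xi])
      then show ?thesis
        using r unfolding scalar_prod_def by (auto intro!: sum.cong)
    qed
    also have "\<dots> = (\<Sum>i\<in>{1..k}. \<Sum>j<n. a i * r $ j * x i $ j)"
      unfolding sum_distrib_right by (subst sum.swap) (simp add: mult_ac)
    also have "\<dots> = (\<Sum>i\<in>{1..k}. (a i \<cdot>\<^sub>v r) \<bullet> x i)"
      unfolding scalar_prod_def using carrier_vecD[OF xi] carrier_vecD[OF r]
      by (intro sum.cong refl) (auto intro!: sum.cong simp: atLeast0LessThan)
    finally show ?thesis by (simp add: map_sum)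
  qed
  have closed: "linear_form n k a x \<in> ?V" if "x \<in> ?T" for x
    unfolding linear_form_def using that by (intro finsum_vec_closed) auto
  have "(\<Sum>r\<in>?V. \<Prod>i\<in>{1..k}. fourier n F (a i \<cdot>\<^sub>v r))
      = (\<Sum>r\<in>?V. \<Sum>x\<in>?T. \<Prod>i\<in>{1..k}. F (x i) * \<psi> ((a i \<cdot>\<^sub>v r) \<bullet> x i))"
    unfolding fourier_def by (subst prod_sum_PiE) auto
  also have "\<dots> = (\<Sum>x\<in>?T. (\<Prod>i\<in>{1..k}. F (x i)) * (\<Sum>r\<in>?V. \<psi> (linear_form n k a x \<bullet> r)))"
    by (subst sum.swap) (auto simp: prod.distrib char sum_distrib_left simp del: One_nat_def intro!: sum.cong)
  also have "\<dots> = (\<Sum>x\<in>?T. if linear_form n k a x = 0\<^sub>v n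
                       then of_nat (CARD('a) ^ n) * (\<Prod>i\<in>{1..k}. F (x i)) else 0)"
    by (intro sum.cong refl) (simp add: orthogonality closed)
  also have "\<dots> = of_nat (CARD('a) ^ n) * (\<Sum>x\<in>solutions n k a ?V. \<Prod>i\<in>{1..k}. F (x i))"
    unfolding solutions_def sum_distrib_left
    by (intro sum.inter_filter[symmetric] finite_PiE) auto
  finally show ?thesis by simp
qed

lemma card_solutions:
  assumes "A \<subseteq> carrier_vec n"
  shows "of_nat (CARD('a) ^ n) * of_nat (card (solutions n k a A))
     = (\<Sum>r\<in>carrier_vec n. \<Prod>i\<in>{1..k}. fourier n (\<lambda>v. of_bool (v \<in> A)) (a i \<cdot>\<^sub>v r))"
proof -
  let ?V = "carrier_vec n :: 'a vec set"
  have fin: "finite (solutions n k a ?V)"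
    unfolding solutions_def by (intro finite_subset[OF Collect_restrict] finite_PiE) auto
  have "(\<Prod>i\<in>{1..k}. of_bool (x i \<in> A)) = (if \<forall>i\<in>{1..k}. x i \<in> A then 1 else 0 :: complex)" for x
    by (auto simp: prod_zero_iff)
  then have "(\<Sum>x\<in>solutions n k a ?V. \<Prod>i\<in>{1..k}. of_bool (x i \<in> A))
     = (of_nat (card {x \<in> solutions n k a ?V. \<forall>i\<in>{1..k}. x i \<in> A}) :: complex)"
    using fin by (simp add: sum.inter_filter[symmetric])
  also have "{x \<in> solutions n k a ?V. \<forall>i\<in>{1..k}. x i \<in> A} = solutions n k a A"
    using assms unfolding solutions_def by (auto simp: PiE_iff)
  finally show ?thesis using sum_over_solutions[where n = n and k = k and a = a and F = "\<lambda>v. of_bool (v \<in> A)"] by simp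
qed

end

section \<open>Colour classes and the threshold for commonness\<close>

lemma solutions_subset_PiE: "solutions n k a A \<subseteq> {1..k} \<rightarrow>\<^sub>E A"
  by (auto simp: solutions_def)

lemma finite_solutions:
  fixes a :: "nat \<Rightarrow> 'a::{field,finite}"
  assumes "A \<subseteq> carrier_vec n"
  shows "finite (solutions n k a A)"
  using assms by (intro finite_subset[OF solutions_subset_PiE] finite_PiE)
    (auto intro: finite_subset[OF _ finite_carrier_vec])

lemma card_monochromatic_solutions:
  fixes a :: "nat \<Rightarrow> 'a::{field,finite}"
  assumes "k \<ge> 1"
  shows "card (monochromatic_solutions n k a c)
    = card (solutions n k a {v \<in> carrier_vec n. c v})
      + card (solutions n k a {v \<in> carrier_vec n. \<not> c v})"
    (is "_ = card (solutions n k a ?A) + card (solutions n k a ?B)")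
proof -
  have one: "1 \<in> {1..k}" using assms by simp
  have "monochromatic_solutions n k a c = solutions n k a ?A \<union> solutions n k a ?B"
  proof (intro equalityI subsetI)
    fix x assume x: "x \<in> monochromatic_solutions n k a c"
    then have "(\<forall>i\<in>{1..k}. c (x i)) \<or> (\<forall>i\<in>{1..k}. \<not> c (x i))"
      unfolding monochromatic_solutions_def by blast
    moreover have "x \<in> solutions n k a (carrier_vec n)"
      using x unfolding monochromatic_solutions_def by blast
    ultimately show "x \<in> solutions n k a ?A \<union> solutions n k a ?B"
      by (auto simp: solutions_def PiE_iff)
  qed (auto simp: monochromatic_solutions_def solutions_def PiE_iff)
  moreover have "solutions n k a ?A \<inter> solutions n k a ?B = {}"
  proof -
    have "c (x 1)" if "x \<in> solutions n k a ?A" for x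
      using that one unfolding solutions_def PiE_iff by blast
    moreover have "\<not> c (x 1)" if "x \<in> solutions n k a ?B" for x
      using that one unfolding solutions_def PiE_iff by blast
    ultimately show ?thesis by blast
  qed
  ultimately show ?thesis
    by (simp add: card_Un_disjoint finite_solutions)
qed

text \<open>
  Convexity of \<open>t \<mapsto> t\<^sup>k\<close> at the midpoint. In the induction step, \<open>x - y\<close> and \<open>x\<^sup>k - y\<^sup>k\<close> have the same
  sign.
\<close>

lemma power_mean:
  fixes x y :: real
  assumes "x \<ge> 0" "y \<ge> 0"
  shows "2 * ((x + y) / 2) ^ k \<le> x ^ k + y ^ k"
proof (induction k)
  case (Suc k)
  have "(x - y) * (x ^ k - y ^ k) \<ge> 0"
  proof (cases "x \<le> y")
    case True
    then show ?thesis using assms by (intro mult_nonpos_nonpos) (auto intro: power_mono)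
  next
    case False
    then show ?thesis using assms by (intro mult_nonneg_nonneg) (auto intro: power_mono)
  qed
  then have "(x + y) * (x ^ k + y ^ k) \<le> 2 * (x ^ Suc k + y ^ Suc k)"
    by (simp add: algebra_simps)
  moreover have "2 * ((x + y) / 2) ^ Suc k = (x + y) * (2 * ((x + y) / 2) ^ k) / 2"
    by simp
  moreover have "\<dots> \<le> (x + y) * (x ^ k + y ^ k) / 2"
    using Suc assms by (intro divide_right_mono mult_left_mono) auto
  ultimately show ?case by simp
qed simp

text \<open>
  The required number of monochromatic solutions is what a colouring with two classes of size \<open>Q / 2\<close>
  gets when both classes have exactly the number of solutions that their density predicts.
\<close>

lemma common_threshold:
  fixes Q :: real
  assumes "k \<ge> 1" "Q > 0"
  shows "2 powi (1 - int k) * Q ^ (k - 1) = 2 * (Q / 2) ^ k / Q"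
proof -
  obtain m where "k = Suc m" using assms(1) by (cases k) auto
  then show ?thesis using assms(2) by (simp add: power_int_minus field_simps)
qed

lemma balanced_bound:
  fixes x y :: real
  assumes "k \<ge> 1" "x \<ge> 0" "y \<ge> 0" "x + y = Q ^ n" "Q > 0"
  shows "2 powi (1 - int k) * Q ^ (n * (k - 1)) \<le> (x ^ k + y ^ k) / Q ^ n"
proof -
  have "2 powi (1 - int k) * (Q ^ n) ^ (k - 1) = 2 * ((x + y) / 2) ^ k / Q ^ n"
    using assms common_threshold[of k "Q ^ n"] by simp
  also have "\<dots> \<le> (x ^ k + y ^ k) / Q ^ n"
    using assms by (intro divide_right_mono power_mean) auto
  finally show ?thesis by (simp add: power_mult)
qed

lemma card_complementary_classes:
  "card {v \<in> (carrier_vec n :: 'a::finite vec set). c v} + card {v \<in> (carrier_vec n :: 'a vec set). \<not> c v}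
    = CARD('a) ^ n"
proof -
  have "card {v \<in> (carrier_vec n :: 'a vec set). c v} + card {v \<in> (carrier_vec n :: 'a vec set). \<not> c v}
    = card ({v \<in> (carrier_vec n :: 'a vec set). c v} \<union> {v \<in> (carrier_vec n :: 'a vec set). \<not> c v})"
    by (intro card_Un_disjoint[symmetric]) auto
  also have "{v \<in> (carrier_vec n :: 'a vec set). c v} \<union> {v \<in> (carrier_vec n :: 'a vec set). \<not> c v} = carrier_vec n"
    by auto
  finally show ?thesis by (simp add: card_carrier_vec)
qed

lemma common_if_sums_bounded:
  fixes a :: "nat \<Rightarrow> 'a::{field,finite}"
  assumes "k \<ge> 1"
    and bound: "\<And>n c. n \<ge> 1 \<Longrightarrow>
      (real (card {v \<in> (carrier_vec n :: 'a vec set). c v}) ^ k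
        + real (card {v \<in> (carrier_vec n :: 'a vec set). \<not> c v}) ^ k) / real CARD('a) ^ n
      \<le> real (card (solutions n k a {v \<in> carrier_vec n. c v}))
        + real (card (solutions n k a {v \<in> carrier_vec n. \<not> c v}))"
  shows "common k a"
  unfolding common_def
proof (intro allI impI)
  fix n :: nat and c :: "'a vec \<Rightarrow> bool"
  assume n: "n \<ge> 1"
  have "real (card {v \<in> (carrier_vec n :: 'a vec set). c v})
      + real (card {v \<in> (carrier_vec n :: 'a vec set). \<not> c v}) = real CARD('a) ^ n"
    unfolding of_nat_add[symmetric] card_complementary_classes by simp
  then have "2 powi (1 - int k) * real CARD('a) ^ (n * (k - 1))
      \<le> (real (card {v \<in> (carrier_vec n :: 'a vec set). c v}) ^ k
        + real (card {v \<in> (carrier_vec n :: 'a vec set). \<not> c v}) ^ k) / real CARD('a) ^ n"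
    by (intro balanced_bound[OF assms(1) of_nat_0_le_iff of_nat_0_le_iff]) (assumption, simp)
  also note bound[OF n]
  finally show "2 powi (1 - int k) * real CARD('a) ^ (n * (k - 1))
      \<le> real (card (monochromatic_solutions n k a c))"
    unfolding card_monochromatic_solutions[OF assms(1)] of_nat_add .
qed

lemma sidorenko_imp_common:
  fixes a :: "nat \<Rightarrow> 'a::{field,finite}"
  assumes "k \<ge> 1" "sidorenko k a"
  shows "common k a"
proof (rule common_if_sums_bounded[OF assms(1)])
  fix n :: nat and c :: "'a vec \<Rightarrow> bool"
  assume "n \<ge> 1"
  then have "real (card {v \<in> carrier_vec n. d v}) ^ k / real CARD('a) ^ n
      \<le> real (card (solutions n k a {v \<in> carrier_vec n. d v}))" for d
    using assms(2)[unfolded sidorenko_def, rule_format, of n "{v \<in> carrier_vec n. d v}"] by auto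
  from add_mono[OF this[of c] this[of "\<lambda>v. \<not> c v"]]
  show "(real (card {v \<in> (carrier_vec n :: 'a vec set). c v}) ^ k
        + real (card {v \<in> (carrier_vec n :: 'a vec set). \<not> c v}) ^ k) / real CARD('a) ^ n
      \<le> real (card (solutions n k a {v \<in> carrier_vec n. c v}))
        + real (card (solutions n k a {v \<in> carrier_vec n. \<not> c v}))"
    by (simp add: add_divide_distrib)
qed

section \<open>Paired coefficients and odd length\<close>

context additive_character
begin

lemma fourier_indicator_zero:
  assumes "A \<subseteq> carrier_vec n"
  shows "fourier n (\<lambda>v. of_bool (v \<in> A)) (0\<^sub>v n) = of_nat (card A)"
  using assms by (simp add: fourier_zero Int_absorb1)

lemma zero_smult_zero: "b \<cdot>\<^sub>v (0\<^sub>v n :: 'a vec) = 0\<^sub>v n"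
  by auto

text \<open>
  The two factors of a zero-sum pair are complex conjugates of each other, so every Fourier term equals
  the product of the moduli of its factors. Dropping all terms but \<open>r = 0\<close> gives the bound.
\<close>

lemma pairing_imp_sidorenko:
  fixes a :: "nat \<Rightarrow> 'a"
  assumes "zero_sum_pairing k a"
  shows "sidorenko k a"
  unfolding sidorenko_def
proof (intro allI impI)
  fix n :: nat and A :: "'a vec set"
  assume A: "A \<subseteq> carrier_vec n"
  define z where "z r i = fourier n (\<lambda>v. of_bool (v \<in> A)) (a i \<cdot>\<^sub>v r)" for r i
  obtain P where P: "partition_on {1..k} P"
    and pairs: "\<And>B. B \<in> P \<Longrightarrow> \<exists>i j. i \<noteq> j \<and> B = {i, j} \<and> a i + a j = 0"
    using assms unfolding zero_sum_pairing_def by blast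
  have nonneg: "(\<Prod>i\<in>{1..k}. z r i) = of_real (\<Prod>i\<in>{1..k}. norm (z r i))"
    if r: "r \<in> carrier_vec n" for r
  proof -
    have splitP: "prod g {1..k} = (\<Prod>B\<in>P. prod g B)" for g :: "nat \<Rightarrow> complex"
    proof -
      have "{1..k} = \<Union>P" using P by (simp add: partition_on_def)
      moreover have "\<forall>B\<in>P. finite B" using pairs by fastforce
      moreover have "\<forall>B\<in>P. \<forall>C\<in>P. B \<noteq> C \<longrightarrow> B \<inter> C = {}"
        using P by (auto simp: partition_on_def disjoint_def)
      ultimately show ?thesis using prod.Union_disjoint[of P g] by simp
    qed
    have "prod (z r) B = (\<Prod>i\<in>B. of_real (norm (z r i)))" if B: "B \<in> P" for B
    proof -
      obtain i j where ij: "i \<noteq> j" "B = {i, j}" "a i + a j = 0" using pairs[OF B] by blast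
      have "z r j = cnj (z r i)"
        unfolding z_def by (rule fourier_opposite[OF _ ij(3) r]) simp
      then show ?thesis
        using ij by (simp add: complex_norm_square[symmetric] power2_eq_square)
    qed
    then show ?thesis by (simp add: splitP del: One_nat_def)
  qed
  have "real CARD('a) ^ n * real (card (solutions n k a A))
      = (\<Sum>r\<in>carrier_vec n. \<Prod>i\<in>{1..k}. norm (z r i))"
  proof -
    have "complex_of_real (real CARD('a) ^ n * real (card (solutions n k a A)))
        = of_real (\<Sum>r\<in>carrier_vec n. \<Prod>i\<in>{1..k}. norm (z r i))"
      using card_solutions[OF A, of k a] by (simp add: z_def[symmetric] nonneg del: One_nat_def)
    then show ?thesis by (simp only: of_real_eq_iff)
  qed
  also have "\<dots> \<ge> (\<Prod>i\<in>{1..k}. norm (z (0\<^sub>v n) i))"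
    by (rule member_le_sum) (auto intro: prod_nonneg)
  also have "(\<Prod>i\<in>{1..k}. norm (z (0\<^sub>v n) i)) = real (card A) ^ k"
    by (simp add: z_def zero_smult_zero fourier_indicator_zero[OF A])
  finally show "real (card A) ^ k / real CARD('a) ^ n \<le> real (card (solutions n k a A))"
    by (simp add: field_simps)
qed

text \<open>
  The indicators of the two classes add up to the constant \<open>1\<close>, whose transform vanishes away from
  \<open>0\<close>. So the transforms of the indicators are opposite there, and an odd number of sign changes makes
  the two products cancel.
\<close>

lemma odd_complement_identity:
  fixes a :: "nat \<Rightarrow> 'a"
  assumes "odd k" "\<forall>i\<in>{1..k}. a i \<noteq> 0"
  shows "real (card (solutions n k a {v \<in> carrier_vec n. c v}))
      + real (card (solutions n k a {v \<in> carrier_vec n. \<not> c v}))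
    = (real (card {v \<in> (carrier_vec n :: 'a vec set). c v}) ^ k
        + real (card {v \<in> (carrier_vec n :: 'a vec set). \<not> c v}) ^ k) / real CARD('a) ^ n"
proof -
  define A where "A = {v \<in> (carrier_vec n :: 'a vec set). c v}"
  define B where "B = {v \<in> (carrier_vec n :: 'a vec set). \<not> c v}"
  have AB: "A \<subseteq> carrier_vec n" "B \<subseteq> carrier_vec n" by (auto simp: A_def B_def)
  let ?f = "\<lambda>A. fourier n (\<lambda>v. of_bool (v \<in> A))"
  let ?t = "\<lambda>r. (\<Prod>i\<in>{1..k}. ?f A (a i \<cdot>\<^sub>v r)) + (\<Prod>i\<in>{1..k}. ?f B (a i \<cdot>\<^sub>v r))"
  have opposite: "?f B s = - ?f A s" if s: "s \<in> carrier_vec n" "s \<noteq> 0\<^sub>v n" for s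
  proof -
    have "?f A s + ?f B s = (\<Sum>v\<in>carrier_vec n. \<psi> (s \<bullet> v))"
      unfolding fourier_def sum.distrib[symmetric] A_def B_def by (intro sum.cong) auto
    then show ?thesis using orthogonality[OF s(1)] s(2) by (simp add: add_eq_0_iff)
  qed
  have cancel: "?t r = 0" if r: "r \<in> carrier_vec n - {0\<^sub>v n}" for r
  proof -
    obtain l where l: "l < n" "r $ l \<noteq> 0"
      using r by (metis DiffE carrier_vecD eq_vecI index_zero_vec insertI1)
    have nz: "a i \<cdot>\<^sub>v r \<noteq> 0\<^sub>v n" if "i \<in> {1..k}" for i
    proof
      assume "a i \<cdot>\<^sub>v r = 0\<^sub>v n"
      then have "(a i \<cdot>\<^sub>v r) $ l = 0" using l by simp
      then show False using l r that assms(2) by auto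
    qed
    have "(\<Prod>i\<in>{1..k}. ?f B (a i \<cdot>\<^sub>v r)) = (\<Prod>i\<in>{1..k}. - 1 * ?f A (a i \<cdot>\<^sub>v r))"
      using r nz by (intro prod.cong refl) (simp add: opposite)
    also have "\<dots> = - (\<Prod>i\<in>{1..k}. ?f A (a i \<cdot>\<^sub>v r))"
      using assms(1) by (simp only: prod.distrib) simp
    finally show ?thesis by simp
  qed
  have "of_nat (CARD('a) ^ n) * of_nat (card (solutions n k a A) + card (solutions n k a B))
      = (\<Sum>r\<in>carrier_vec n. ?t r)"
    using card_solutions[OF AB(1), of k a] card_solutions[OF AB(2), of k a]
    by (simp add: sum.distrib ring_distribs)
  also have "\<dots> = ?t (0\<^sub>v n)"
    using cancel by (subst sum.remove[of _ "0\<^sub>v n"]) auto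
  also have "\<dots> = of_nat (card A ^ k + card B ^ k)"
    by (simp add: zero_smult_zero fourier_indicator_zero AB)
  finally have "CARD('a) ^ n * (card (solutions n k a A) + card (solutions n k a B))
      = card A ^ k + card B ^ k"
    by (simp only: of_nat_eq_iff of_nat_mult[symmetric])
  from arg_cong[OF this, of real] show ?thesis
    unfolding A_def[symmetric] B_def[symmetric] by (simp add: field_simps)
qed

lemma odd_imp_common:
  fixes a :: "nat \<Rightarrow> 'a"
  assumes "odd k" "\<forall>i\<in>{1..k}. a i \<noteq> 0"
  shows "common k a"
  using assms by (intro common_if_sums_bounded) (auto simp: odd_complement_identity odd_pos Suc_leI)

text \<open>
  By \<open>odd_complement_identity\<close> a surplus of solutions in a set is a deficit in its complement. The set
  \<open>{0}\<close> has one solution instead of the predicted \<open>1 / q\<close>, so the set of nonzero elements violates the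
  Sidorenko bound already in dimension \<open>1\<close>.
\<close>

lemma odd_imp_not_sidorenko:
  fixes a :: "nat \<Rightarrow> 'a"
  assumes "odd k" "\<forall>i\<in>{1..k}. a i \<noteq> 0"
  shows "\<not> sidorenko k a"
proof
  assume sid: "sidorenko k a"
  have k: "k \<ge> 1" using assms(1) by (cases k) auto
  let ?q = "real CARD('a)"
  let ?A = "{v \<in> (carrier_vec 1 :: 'a vec set). v \<noteq> 0\<^sub>v 1}"
  have zero: "{v \<in> (carrier_vec 1 :: 'a vec set). \<not> v \<noteq> 0\<^sub>v 1} = {0\<^sub>v 1}" by auto
  let ?x = "\<lambda>i\<in>{1..k}. 0\<^sub>v 1 :: 'a vec"
  have lin: "linear_form 1 k a ?x = 0\<^sub>v 1"
  proof (rule eq_vecI)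
    have closed: "linear_form 1 k a ?x \<in> carrier_vec 1"
      unfolding linear_form_def by (intro finsum_vec_closed) auto
    then show "dim_vec (linear_form 1 k a ?x) = dim_vec (0\<^sub>v 1 :: 'a vec)" by auto
    show "linear_form 1 k a ?x $ i = 0\<^sub>v 1 $ i" if "i < dim_vec (0\<^sub>v 1 :: 'a vec)" for i
      using that unfolding linear_form_def by (subst index_finsum_vec) auto
  qed
  then have "?x \<in> solutions 1 k a {0\<^sub>v 1}"
    unfolding solutions_def by auto
  then have "card (solutions 1 k a {0\<^sub>v 1}) \<ge> 1"
    using finite_solutions[of "{0\<^sub>v 1}" 1 k a]
    by (metis One_nat_def Suc_leI card_gt_0_iff empty_iff empty_subsetI insert_subset zero_carrier_vec)
  moreover have "real (card (solutions 1 k a ?A)) + real (card (solutions 1 k a {0\<^sub>v 1}))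
      = (real (card ?A) ^ k + 1) / ?q"
    using odd_complement_identity[OF assms, of 1 "\<lambda>v. v \<noteq> 0\<^sub>v 1"] unfolding zero by simp
  moreover have "real (card (solutions 1 k a ?A)) \<ge> real (card ?A) ^ k / ?q ^ 1"
    using sid unfolding sidorenko_def by (metis (no_types, lifting) mem_Collect_eq order_refl subsetI)
  moreover have "1 / ?q < 1"
  proof -
    have "card {0, 1 :: 'a} \<le> CARD('a)" by (intro card_mono) auto
    then show ?thesis by simp
  qed
  ultimately show False by (simp add: add_divide_distrib)
qed

end

section \<open>Phases that make the Fourier expansion negative\<close>

lemma cis_root_power_neq_1:
  assumes "0 < m" "m < N"
  shows "cis (2 * pi / real N) ^ m \<noteq> 1"
proof
  assume "cis (2 * pi / real N) ^ m = 1"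
  then have "cis (real m * (2 * pi / real N)) = 1" by (simp add: DeMoivre)
  then have "cos (real m * (2 * pi / real N)) = 1" by (simp add: complex_eq_iff)
  then obtain j :: int where "real m * (2 * pi / real N) = of_int j * 2 * pi"
    by (auto simp: cos_one_2pi_int)
  then have "real m = of_int j * real N"
    using assms by (simp add: field_simps)
  then have "int m = j * int N"
    by (metis of_int_eq_iff of_int_mult of_int_of_nat_eq)
  then have "int N dvd int m" by simp
  then have "N dvd m" by presburger
  with assms show False by (auto dest: dvd_imp_le)
qed

text \<open>
  These functions form a group under pointwise multiplication. For \<open>N > 0\<close> the value \<open>s b\<close> has modulus
  \<open>1\<close>, so the second condition says that \<open>s (- b)\<close> is conjugate to \<open>s b\<close>. It is written as a product
  so that closure under multiplication and cancellation of zero-sum pairs are immediate.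
\<close>

definition phases :: "nat \<Rightarrow> ('a::field \<Rightarrow> complex) set" where
  "phases N = {s. \<forall>b. s b ^ N = 1 \<and> s b * s (- b) = 1}"

lemma finite_phases:
  assumes "N > 0"
  shows "finite (phases N :: ('a::{field,finite} \<Rightarrow> complex) set)"
proof (rule finite_subset)
  show "phases N \<subseteq> (UNIV :: 'a set) \<rightarrow>\<^sub>E {z. z ^ N = 1}"
    by (auto simp: phases_def)
  show "finite ((UNIV :: 'a set) \<rightarrow>\<^sub>E {z :: complex. z ^ N = 1})"
    using assms by (intro finite_PiE) (auto intro: finite_nth_roots)
qed

lemma phases_norm:
  assumes "s \<in> phases N" "N > 0"
  shows "norm (s b) = 1"
proof -
  have "norm (s b) ^ N = 1"
    using assms(1) by (simp add: phases_def norm_power[symmetric])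
  then show ?thesis using assms(2) by (metis norm_ge_zero power_eq_iff_eq_base power_one zero_le_one)
qed

lemma phases_cnj:
  assumes "s \<in> phases N" "N > 0"
  shows "s (- b) = cnj (s b)"
proof -
  have "s b * s (- b) = s b * cnj (s b)"
    using assms phases_norm[OF assms, of b] by (simp add: phases_def complex_norm_square[symmetric])
  moreover have "s b \<noteq> 0" using phases_norm[OF assms, of b] by auto
  ultimately show ?thesis by simp
qed

text \<open>
  Zero-sum pairs can be split off, because \<open>s\<close> takes inverse values on \<open>b\<close> and \<open>- b\<close>. If an index \<open>i\<close>
  has no mate, an \<open>s\<close> that differs from \<open>1\<close> only at \<open>\<plusminus> a i\<close> detects it. When \<open>a i\<close> and \<open>- a i\<close>
  differ, its value at \<open>a i\<close> can be a primitive \<open>N\<close>-th root of unity. The product is then a power of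
  this root, whose exponent is the multiplicity of \<open>a i\<close> and hence less than \<open>N\<close>. When \<open>a i = - a i\<close>,
  the value has to be \<open>- 1\<close>, an \<open>N\<close>-th root of unity because \<open>N\<close> is even. The multiplicity of \<open>a i\<close>
  is then \<open>1\<close>, since an equal coefficient would be a mate.
\<close>

lemma pairing_if_phases_trivial:
  fixes a :: "'i \<Rightarrow> 'a::field"
  assumes "finite I" "card I < N" "even N"
    and "\<And>s. s \<in> phases N \<Longrightarrow> (\<Prod>i\<in>I. s (a i)) = 1"
  shows "\<exists>P. partition_on I P \<and> (\<forall>B\<in>P. \<exists>i j. i \<noteq> j \<and> B = {i, j} \<and> a i + a j = 0)"
  using assms
proof (induction I rule: finite_psubset_induct)
  case (psubset I)
  show ?case
  proof (cases "I = {}")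
    case True
    then show ?thesis by (intro exI[of _ "{}"]) (simp add: partition_on_empty)
  next
    case False
    then obtain i where i: "i \<in> I" by blast
    show ?thesis
    proof (cases "\<exists>j\<in>I. j \<noteq> i \<and> a j = - a i")
      case True
      then obtain j where j: "j \<in> I" "j \<noteq> i" "a j = - a i" by blast
      let ?I = "I - {i, j}"
      have "(\<Prod>l\<in>?I. s (a l)) = 1" if s: "s \<in> phases N" for s
      proof -
        have "(\<Prod>l\<in>I. s (a l)) = (\<Prod>l\<in>?I. s (a l)) * (\<Prod>l\<in>{i, j}. s (a l))"
          using psubset.hyps i j by (intro prod.subset_diff) auto
        also have "(\<Prod>l\<in>{i, j}. s (a l)) = 1"
          using s j by (auto simp: phases_def)
        finally show ?thesis using psubset.prems(3)[OF s] by simp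
      qed
      moreover have "card ?I < N"
        using psubset.prems(1) psubset.hyps card_mono[of I ?I] by auto
      ultimately obtain P where P: "partition_on ?I P"
        "\<forall>B\<in>P. \<exists>i j. i \<noteq> j \<and> B = {i, j} \<and> a i + a j = 0"
        using psubset.IH[of ?I] psubset.prems i by blast
      have "partition_on I (insert {i, j} P)"
        using P(1) i j by (subst partition_on_insert) (auto simp: partition_on_def disjnt_def)
      moreover have "\<forall>B\<in>insert {i, j} P. \<exists>i j. i \<noteq> j \<and> B = {i, j} \<and> a i + a j = 0"
        using P(2) j by (metis add.right_inverse insert_iff)
      ultimately show ?thesis by blast
    next
      case no_mate: False
      let ?b = "a i"
      have "\<exists>s\<in>phases N. (\<Prod>l\<in>I. s (a l)) \<noteq> 1"
      proof (cases "- ?b = ?b")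
        case True
        define s where "s b = (if b = ?b then - 1 else 1 :: complex)" for b
        have "- b \<noteq> ?b" if "b \<noteq> ?b" for b
          using that True by (metis minus_minus)
        then have "s \<in> phases N"
          using True psubset.prems(2) by (auto simp: phases_def s_def)
        moreover have "(\<Prod>l\<in>I. s (a l)) = s (a i) * (\<Prod>l\<in>I - {i}. s (a l))"
          using i psubset.hyps by (simp add: prod.remove)
        moreover have "(\<Prod>l\<in>I - {i}. s (a l)) = 1"
          using no_mate True by (intro prod.neutral) (auto simp: s_def)
        ultimately show ?thesis by (intro bexI[of _ s]) (auto simp: s_def)
      next
        case False
        define w where "w = cis (2 * pi / real N)"
        have N: "N > 0" using psubset.prems(1) by auto
        have wN: "w ^ N = 1" using N by (simp add: w_def DeMoivre)
        have ww: "w * cnj w = 1" by (simp add: w_def complex_norm_square[symmetric])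
        define s where "s b = (if b = ?b then w else if b = - ?b then cnj w else 1)" for b
        have "- b = ?b \<longleftrightarrow> b = - ?b" for b by (metis minus_minus)
        then have "s \<in> phases N"
          using False wN ww
          by (auto simp: phases_def s_def mult.commute complex_cnj_power[symmetric]
              simp del: complex_cnj_power)
        moreover have "(\<Prod>l\<in>I. s (a l)) = (\<Prod>l\<in>I. if a l = ?b then w else 1)"
          using no_mate False by (intro prod.cong refl) (auto simp: s_def)
        then have "(\<Prod>l\<in>I. s (a l)) = w ^ card {l \<in> I. a l = ?b}"
          using psubset.hyps by (simp add: prod.inter_filter[symmetric])
        moreover have "w ^ card {l \<in> I. a l = ?b} \<noteq> 1"
          unfolding w_def
        proof (rule cis_root_power_neq_1)
          show "0 < card {l \<in> I. a l = ?b}"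
            using i psubset.hyps by (auto simp: card_gt_0_iff)
          show "card {l \<in> I. a l = ?b} < N"
            using psubset.prems(1) card_mono[of I "{l \<in> I. a l = ?b}"] psubset.hyps by auto
        qed
        ultimately show ?thesis by metis
      qed
      then show ?thesis using psubset.prems(3) by blast
    qed
  qed
qed

text \<open>
  The summand is a character of the group of phases, and \<open>s0\<close>, rescaled by \<open>r\<close>, shows that it is
  nontrivial. The sum is invariant under translation by the rescaled \<open>s0\<close> and hence vanishes.
\<close>

lemma sum_over_phases_eq_0:
  fixes a :: "'i \<Rightarrow> 'a::field"
  assumes s0: "s0 \<in> phases N" "(\<Prod>i\<in>I. s0 (a i)) \<noteq> 1"
    and r: "r \<noteq> 0"
  shows "(\<Sum>s\<in>phases N. \<Prod>i\<in>I. s (a i * r)) = 0"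
proof -
  define t where "t b = s0 (b / r)" for b
  have t: "t \<in> phases N"
    using s0(1) by (simp add: phases_def t_def)
  have inv: "t b * t (- b) = 1" "t (- b) * t b = 1" for b
    using t by (auto simp: phases_def mult.commute)
  have ta: "(\<Prod>i\<in>I. t (a i * r)) = (\<Prod>i\<in>I. s0 (a i))"
    using r by (simp add: t_def)
  have closed: "(\<lambda>b. u b * s b) \<in> phases N" if "u \<in> phases N" "s \<in> phases N" for u s :: "'a \<Rightarrow> complex"
  proof -
    have "u b * s b * (u (- b) * s (- b)) = (u b * u (- b)) * (s b * s (- b))" for b
      by (simp add: mult_ac)
    moreover have "u b * u (- b) = 1" "s b * s (- b) = 1" for b
      using that by (simp_all add: phases_def)
    ultimately show ?thesis using that by (simp add: phases_def power_mult_distrib)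
  qed
  have t': "(\<lambda>b. t (- b)) \<in> phases N"
    using t by (simp add: phases_def mult.commute)
  let ?S = "\<Sum>s\<in>phases N. \<Prod>i\<in>I. s (a i * r)"
  have "?S = (\<Sum>s\<in>phases N. \<Prod>i\<in>I. t (a i * r) * s (a i * r))"
  proof (rule sum.reindex_bij_witness[of _ "\<lambda>s b. t b * s b" "\<lambda>s b. t (- b) * s b"])
    fix s :: "'a \<Rightarrow> complex" assume s: "s \<in> phases N"
    show "(\<lambda>b. t b * (t (- b) * s b)) = s" "(\<lambda>b. t (- b) * (t b * s b)) = s"
      by (simp_all add: mult.assoc[symmetric] inv)
    show "(\<lambda>b. t (- b) * s b) \<in> phases N" "(\<lambda>b. t b * s b) \<in> phases N"
      using closed t' t s by auto
    show "(\<Prod>i\<in>I. t (a i * r) * (t (- (a i * r)) * s (a i * r))) = (\<Prod>i\<in>I. s (a i * r))"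
      by (simp add: mult.assoc[symmetric] inv)
  qed
  also have "\<dots> = (\<Prod>i\<in>I. s0 (a i)) * ?S"
    by (simp add: prod.distrib ta sum_distrib_left)
  finally have "(1 - (\<Prod>i\<in>I. s0 (a i))) * ?S = 0" by (simp add: algebra_simps)
  then show ?thesis using s0(2) by simp
qed

text \<open>
  The average over all phases is \<open>0\<close> for every \<open>r\<close>, but the constant phase \<open>1\<close> contributes a positive
  amount, which some other phase has to compensate. With the \<open>2k\<close>-th roots of unity the order is even and
  exceeds all multiplicities of coefficients, as the detection of unpaired coefficients demands.
\<close>

lemma negative_phases_exist:
  fixes a :: "nat \<Rightarrow> 'a::{field,finite}"
  assumes "k \<ge> 1" "\<not> zero_sum_pairing k a"
  shows "\<exists>s. (\<forall>b. s (- b) = cnj (s b)) \<and> (\<forall>b. norm (s b) = 1)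
    \<and> Re (\<Sum>r\<in>UNIV - {0}. \<Prod>i\<in>{1..k}. s (a i * r)) < 0"
proof -
  let ?N = "2 * k"
  let ?S = "\<lambda>s. \<Sum>r\<in>UNIV - {0}. \<Prod>i\<in>{1..k}. s (a i * r)"
  have N: "?N > 0" using assms(1) by simp
  obtain s0 where s0: "s0 \<in> phases ?N" "(\<Prod>i\<in>{1..k}. s0 (a i)) \<noteq> 1"
  proof -
    have "\<not> (\<forall>s. s \<in> phases ?N \<longrightarrow> (\<Prod>i\<in>{1..k}. s (a i)) = 1)"
    proof
      assume "\<forall>s. s \<in> phases ?N \<longrightarrow> (\<Prod>i\<in>{1..k}. s (a i)) = 1"
      moreover have "card {1..k} < ?N" using assms(1) by simp
      ultimately have "\<exists>P. partition_on {1..k} P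
          \<and> (\<forall>B\<in>P. \<exists>i j. i \<noteq> j \<and> B = {i, j} \<and> a i + a j = 0)"
        by (intro pairing_if_phases_trivial[of "{1..k}" ?N a]) simp_all
      with assms(2) show False unfolding zero_sum_pairing_def by contradiction
    qed
    then show ?thesis using that by blast
  qed
  have "(\<Sum>s\<in>phases ?N. ?S s) = 0"
  proof (subst sum.swap, rule sum.neutral, rule ballI)
    fix r :: 'a assume "r \<in> UNIV - {0}"
    then show "(\<Sum>s\<in>phases ?N. \<Prod>i\<in>{1..k}. s (a i * r)) = 0"
      by (intro sum_over_phases_eq_0[OF s0]) simp
  qed
  then have total: "(\<Sum>s\<in>phases ?N. Re (?S s)) = 0"
    by (simp only: Re_sum[symmetric]) simp
  have one: "(\<lambda>_. 1) \<in> phases ?N" by (simp add: phases_def)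
  \<comment> \<open>For the constant phase \<open>1\<close> the inner sum counts the nonzero field elements, of which there is
     at least one.\<close>
  have "card {1 :: 'a} \<le> card (UNIV - {0 :: 'a})" by (intro card_mono) auto
  then have pos: "Re (?S (\<lambda>_. 1)) > 0" by simp
  have "\<exists>s\<in>phases ?N. Re (?S s) < 0"
  proof (rule ccontr)
    assume "\<not> ?thesis"
    then have "Re (?S (\<lambda>_. 1)) \<le> (\<Sum>s\<in>phases ?N. Re (?S s))"
      using one finite_phases[OF N, where 'a = 'a]
      by (intro member_le_sum[of "\<lambda>_. 1" "phases ?N" "\<lambda>s. Re (?S s)"]) (auto simp: not_less)
    with total pos show False by simp
  qed
  then show ?thesis using phases_cnj[OF _ N] phases_norm[OF _ N] by blast
qed

section \<open>A fractional colouring with too few monochromatic solutions\<close>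

context additive_character
begin

text \<open>
  The function on \<open>\<bbbF>\<^sub>q\<^sup>n\<close> whose Fourier transform, up to the factor \<open>q\<^sup>n\<close>, is \<open>c\<close> on the line spanned
  by the first unit vector and \<open>0\<close> elsewhere. It makes a choice of Fourier coefficients on the field
  available in every dimension at once.
\<close>

definition line_function :: "nat \<Rightarrow> ('a \<Rightarrow> complex) \<Rightarrow> 'a vec \<Rightarrow> complex" where
  "line_function n c v = (\<Sum>b\<in>UNIV. c b * \<psi> (- (b * v $ 0)))"

lemma fourier_line_function:
  assumes n: "n \<ge> 1" and r: "r \<in> carrier_vec n"
  shows "fourier n (line_function n c) r
    = (if r = r $ 0 \<cdot>\<^sub>v unit_vec n 0 then of_nat (CARD('a) ^ n) * c (r $ 0) else 0)"
proof -
  let ?e = "unit_vec n 0 :: 'a vec"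
  have char: "\<psi> (- (b * v $ 0)) * \<psi> (r \<bullet> v) = \<psi> ((r - b \<cdot>\<^sub>v ?e) \<bullet> v)" if v: "v \<in> carrier_vec n" for b v
  proof -
    have "(r - b \<cdot>\<^sub>v ?e) \<bullet> v = r \<bullet> v - b * v $ 0"
      using n r v by (subst minus_scalar_prod_distrib[of _ n]) auto
    then show ?thesis by (simp add: map_add[symmetric])
  qed
  have iff: "r - b \<cdot>\<^sub>v ?e = 0\<^sub>v n \<longleftrightarrow> r = b \<cdot>\<^sub>v ?e" for b
  proof
    assume *: "r - b \<cdot>\<^sub>v ?e = 0\<^sub>v n"
    show "r = b \<cdot>\<^sub>v ?e"
    proof (rule eq_vecI)
      fix i assume i: "i < dim_vec (b \<cdot>\<^sub>v ?e)"
      then have "(r - b \<cdot>\<^sub>v ?e) $ i = 0" using * by simp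
      then show "r $ i = (b \<cdot>\<^sub>v ?e) $ i" using i by simp
    qed (use r in auto)
  qed (use r in auto)
  have on_line: "r = b \<cdot>\<^sub>v ?e \<longleftrightarrow> b = r $ 0 \<and> r = r $ 0 \<cdot>\<^sub>v ?e" for b
  proof
    assume *: "r = b \<cdot>\<^sub>v ?e"
    then have "r $ 0 = b" using n by simp
    with * show "b = r $ 0 \<and> r = r $ 0 \<cdot>\<^sub>v ?e" by simp
  qed auto
  have "fourier n (line_function n c) r
      = (\<Sum>v\<in>carrier_vec n. \<Sum>b\<in>UNIV. c b * \<psi> ((r - b \<cdot>\<^sub>v ?e) \<bullet> v))"
    unfolding fourier_def line_function_def sum_distrib_right
    by (intro sum.cong refl) (simp add: mult.assoc char)
  also have "\<dots> = (\<Sum>b\<in>UNIV. c b * (\<Sum>v\<in>carrier_vec n. \<psi> ((r - b \<cdot>\<^sub>v ?e) \<bullet> v)))"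
    by (subst sum.swap) (simp add: sum_distrib_left)
  also have "\<dots> = (\<Sum>b\<in>UNIV. c b * (if r = b \<cdot>\<^sub>v ?e then of_nat (CARD('a) ^ n) else 0))"
    using r by (intro sum.cong refl, subst orthogonality) (auto simp: iff)
  also have "\<dots> = (\<Sum>b\<in>UNIV. if b = r $ 0
      then (if r = r $ 0 \<cdot>\<^sub>v ?e then of_nat (CARD('a) ^ n) * c b else 0) else 0)"
    by (intro sum.cong refl) (subst on_line, auto)
  finally show ?thesis by simp
qed

text \<open>
  Since the coefficients are nonzero, \<open>a\<^sub>i r\<close> lies on the line only if \<open>r\<close> does. So only the \<open>r\<close> on the
  line contribute, and what remains is a sum over the field that is independent of \<open>n\<close>.
\<close>

lemma sum_over_solutions_line_function:
  assumes n: "n \<ge> 1" and k: "k \<ge> 1" and nz: "\<forall>i\<in>{1..k}. a i \<noteq> 0"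
  shows "(\<Sum>x\<in>solutions n k a (carrier_vec n). \<Prod>i\<in>{1..k}. line_function n c (x i))
    = of_nat (CARD('a) ^ n) ^ (k - 1) * (\<Sum>b\<in>UNIV. \<Prod>i\<in>{1..k}. c (a i * b))"
proof -
  let ?V = "carrier_vec n :: 'a vec set"
  let ?Q = "of_nat (CARD('a) ^ n) :: complex"
  let ?e = "unit_vec n 0 :: 'a vec"
  let ?F = "\<lambda>r. \<Prod>i\<in>{1..k}. fourier n (line_function n c) (a i \<cdot>\<^sub>v r)"
  have off: "?F r = 0" if r: "r \<in> ?V - range (\<lambda>b. b \<cdot>\<^sub>v ?e)" for r
  proof -
    have a1: "a 1 \<noteq> 0" using nz k by simp
    have "a 1 \<cdot>\<^sub>v r \<noteq> (a 1 \<cdot>\<^sub>v r) $ 0 \<cdot>\<^sub>v ?e"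
    proof
      assume eq: "a 1 \<cdot>\<^sub>v r = (a 1 \<cdot>\<^sub>v r) $ 0 \<cdot>\<^sub>v ?e"
      have "r = r $ 0 \<cdot>\<^sub>v ?e"
      proof (rule eq_vecI)
        fix i assume i: "i < dim_vec (r $ 0 \<cdot>\<^sub>v ?e)"
        then have "a 1 * r $ i = a 1 * (r $ 0 * ?e $ i)"
          using arg_cong[OF eq, of "\<lambda>v. v $ i"] n r by auto
        then show "r $ i = (r $ 0 \<cdot>\<^sub>v ?e) $ i" using a1 i by simp
      qed (use r in auto)
      with r show False by auto
    qed
    then have "fourier n (line_function n c) (a 1 \<cdot>\<^sub>v r) = 0"
      using fourier_line_function[OF n, of "a 1 \<cdot>\<^sub>v r" c] r by auto
    then show ?thesis using k by (intro prod_zero) auto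
  qed
  have on: "?F (b \<cdot>\<^sub>v ?e) = ?Q ^ k * (\<Prod>i\<in>{1..k}. c (a i * b))" for b
  proof -
    have "fourier n (line_function n c) (a i \<cdot>\<^sub>v (b \<cdot>\<^sub>v ?e)) = ?Q * c (a i * b)" for i
      using n by (subst fourier_line_function[OF n]) (auto simp: smult_smult_assoc)
    then show ?thesis by (simp add: prod.distrib)
  qed
  have inj: "inj (\<lambda>b. b \<cdot>\<^sub>v ?e)"
  proof (rule injI)
    fix b b' assume "b \<cdot>\<^sub>v ?e = b' \<cdot>\<^sub>v ?e"
    then have "(b \<cdot>\<^sub>v ?e) $ 0 = (b' \<cdot>\<^sub>v ?e) $ 0" by simp
    then show "b = b'" using n by simp
  qed
  have "?Q * (\<Sum>x\<in>solutions n k a ?V. \<Prod>i\<in>{1..k}. line_function n c (x i)) = (\<Sum>r\<in>?V. ?F r)"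
    by (rule sum_over_solutions)
  also have "\<dots> = (\<Sum>r\<in>range (\<lambda>b. b \<cdot>\<^sub>v ?e). ?F r)"
    using off by (intro sum.mono_neutral_right) auto
  also have "\<dots> = (\<Sum>b\<in>UNIV. ?F (b \<cdot>\<^sub>v ?e))"
    by (simp only: sum.reindex[OF inj] o_def)
  also have "\<dots> = ?Q * (?Q ^ (k - 1) * (\<Sum>b\<in>UNIV. \<Prod>i\<in>{1..k}. c (a i * b)))"
    using k by (simp only: on sum_distrib_left[symmetric]) (cases k, simp_all)
  finally show ?thesis by simp
qed

lemma line_function_real:
  assumes "\<And>b. c (- b) = cnj (c b)"
  shows "cnj (line_function n c v) = line_function n c v"
proof -
  have "cnj (line_function n c v) = (\<Sum>b\<in>UNIV. c (- b) * \<psi> (- (- b * v $ 0)))"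
    unfolding line_function_def by (simp add: assms map_uminus)
  also have "\<dots> = line_function n c v"
    unfolding line_function_def by (rule sum.reindex_bij_witness[of _ uminus uminus]) auto
  finally show ?thesis .
qed

text \<open>
  The weights of \<open>f\<close> and \<open>1 - f\<close> as fractional colour classes add up to less than the threshold for
  commonness, by a proportion that does not depend on \<open>n\<close>. This uniformity makes error terms that are
  small for large \<open>n\<close> harmless. Both weights are the same because the Fourier coefficients of \<open>f\<close> and
  \<open>1 - f\<close> away from \<open>0\<close> differ only in sign and \<open>k\<close> is even.
\<close>

lemma negative_fractional_colouring:
  fixes a :: "nat \<Rightarrow> 'a"
  assumes k: "even k" "k \<ge> 1" and nz: "\<forall>i\<in>{1..k}. a i \<noteq> 0" and np: "\<not> zero_sum_pairing k a"
  obtains \<tau> where "\<tau> > 0"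
    and "\<And>n. n \<ge> 1 \<Longrightarrow> \<exists>f :: 'a vec \<Rightarrow> real. (\<forall>v. 0 \<le> f v \<and> f v \<le> 1) \<and>
      (\<Sum>x\<in>solutions n k a (carrier_vec n). (\<Prod>i\<in>{1..k}. f (x i)) + (\<Prod>i\<in>{1..k}. 1 - f (x i)))
        = real (CARD('a) ^ n) ^ (k - 1) * (2 * (1 / 2) ^ k - \<tau>)"
proof -
  obtain s where s: "\<And>b. s (- b) = cnj (s b)" "\<And>b. norm (s b) = 1"
    and neg: "Re (\<Sum>r\<in>UNIV - {0}. \<Prod>i\<in>{1..k}. s (a i * r)) < 0"
    using negative_phases_exist[OF k(2) np] by blast
  let ?q = "real CARD('a)"
  \<comment> \<open>There are fewer than \<open>q\<close> coefficients of modulus \<open>\<epsilon>\<close>, so they move \<open>f\<close> by at most \<open>1 / 2\<close>.\<close>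
  define \<epsilon> where "\<epsilon> = 1 / (2 * ?q)"
  have \<epsilon>: "\<epsilon> > 0" by (simp add: \<epsilon>_def)
  \<comment> \<open>The parameters \<open>t = \<epsilon>\<close> and \<open>t = - \<epsilon>\<close> give \<open>f\<close> and \<open>1 - f\<close>.\<close>
  define c where "c t b = (if b = 0 then 1 / 2 else of_real t * s b)" for t b
  let ?T = "Re (\<Sum>r\<in>UNIV - {0}. \<Prod>i\<in>{1..k}. s (a i * r))"
  define \<tau> where "\<tau> = - 2 * \<epsilon> ^ k * ?T"
  have \<tau>: "\<tau> > 0" using neg \<epsilon> by (simp add: \<tau>_def mult_pos_neg)
  have c_cnj: "c t (- b) = cnj (c t b)" for t b by (simp add: c_def s)
  have c_sum: "Re (\<Sum>b\<in>UNIV. \<Prod>i\<in>{1..k}. c t (a i * b)) = (1 / 2) ^ k - \<tau> / 2" if "t ^ k = \<epsilon> ^ k" for t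
  proof -
    have "(\<Prod>i\<in>{1..k}. c t (a i * b)) = of_real (\<epsilon> ^ k) * (\<Prod>i\<in>{1..k}. s (a i * b))" if b: "b \<noteq> 0" for b
    proof -
      have "(\<Prod>i\<in>{1..k}. c t (a i * b)) = (\<Prod>i\<in>{1..k}. of_real t * s (a i * b))"
        using b nz by (intro prod.cong) (auto simp: c_def)
      then show ?thesis by (simp add: prod.distrib \<open>t ^ k = \<epsilon> ^ k\<close>[symmetric])
    qed
    then have "(\<Sum>b\<in>UNIV. \<Prod>i\<in>{1..k}. c t (a i * b))
        = (1 / 2) ^ k + of_real (\<epsilon> ^ k) * (\<Sum>b\<in>UNIV - {0}. \<Prod>i\<in>{1..k}. s (a i * b))"
      by (subst sum.remove[of _ 0]) (simp_all add: c_def sum_distrib_left)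
    moreover have "Re ((1 / 2) ^ k) = (1 / 2) ^ k"
      using Re_complex_of_real[of "(1 / 2) ^ k"] by simp
    ultimately show ?thesis by (simp add: \<tau>_def del: of_real_power Re_sum)
  qed
  show ?thesis
  proof (rule that[OF \<tau>])
    fix n :: nat assume n: "n \<ge> 1"
    define F where "F t = line_function n (c t)" for t
    have F_split: "F t v = 1 / 2 + of_real t * (\<Sum>b\<in>UNIV - {0}. s b * \<psi> (- (b * v $ 0)))" for t v
    proof -
      have "F t v = c t 0 * \<psi> (- (0 * v $ 0)) + (\<Sum>b\<in>UNIV - {0}. c t b * \<psi> (- (b * v $ 0)))"
        unfolding F_def line_function_def by (rule sum.remove) auto
      also have "(\<Sum>b\<in>UNIV - {0}. c t b * \<psi> (- (b * v $ 0)))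
          = of_real t * (\<Sum>b\<in>UNIV - {0}. s b * \<psi> (- (b * v $ 0)))"
        unfolding sum_distrib_left by (intro sum.cong) (auto simp: c_def)
      finally show ?thesis by (simp add: c_def map_zero)
    qed
    define f where "f v = Re (F \<epsilon> v)" for v
    have Ff: "F \<epsilon> v = of_real (f v)" for v
      using line_function_real[of "c \<epsilon>" n v, OF c_cnj] unfolding f_def F_def
      by (metis Reals_cnj_iff of_real_Re)
    have Fg: "F (- \<epsilon>) v = of_real (1 - f v)" for v
    proof -
      have "F (- \<epsilon>) v = 1 - F \<epsilon> v" unfolding F_split by simp
      then show ?thesis by (simp add: Ff)
    qed
    have "0 \<le> f v \<and> f v \<le> 1" for v
    proof -
      let ?G = "\<Sum>b\<in>UNIV - {0}. s b * \<psi> (- (b * v $ 0))"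
      define z where "z = of_real \<epsilon> * ?G"
      have "norm ?G \<le> (\<Sum>b\<in>UNIV - {0 :: 'a}. 1)"
        by (rule order_trans[OF norm_sum]) (simp add: norm_mult s norm_eq_1)
      also have "\<dots> \<le> ?q" by (simp add: card_Diff_singleton)
      finally have "\<epsilon> * norm ?G \<le> \<epsilon> * ?q"
        using \<epsilon> by (intro mult_left_mono) auto
      moreover have "norm z = \<epsilon> * norm ?G"
        using \<epsilon> by (simp only: z_def norm_mult norm_of_real abs_of_pos)
      moreover have "\<epsilon> * ?q = 1 / 2" by (simp add: \<epsilon>_def)
      ultimately have "norm z \<le> 1 / 2" by simp
      then have "\<bar>Re z\<bar> \<le> 1 / 2"
        using abs_Re_le_cmod[of z] by simp
      moreover have "f v = 1 / 2 + Re z" unfolding f_def F_split z_def by simp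
      ultimately show ?thesis by linarith
    qed
    moreover have sol: "(\<Sum>x\<in>solutions n k a (carrier_vec n). \<Prod>i\<in>{1..k}. h (x i))
        = real (CARD('a) ^ n) ^ (k - 1) * ((1 / 2) ^ k - \<tau> / 2)"
      if "t ^ k = \<epsilon> ^ k" "\<And>v. F t v = of_real (h v)" for t and h :: "'a vec \<Rightarrow> real"
    proof -
      have "of_real (\<Sum>x\<in>solutions n k a (carrier_vec n). \<Prod>i\<in>{1..k}. h (x i))
          = of_real (real (CARD('a) ^ n) ^ (k - 1)) * (\<Sum>b\<in>UNIV. \<Prod>i\<in>{1..k}. c t (a i * b))"
        using sum_over_solutions_line_function[OF n k(2) nz, of "c t"]
        unfolding F_def[symmetric] that(2) by simp
      from arg_cong[OF this, of Re] show ?thesis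
        using c_sum[OF that(1)] by (simp del: Re_sum of_real_sum of_real_prod of_real_power)
    qed
    have "(- \<epsilon>) ^ k = \<epsilon> ^ k" using k(1) by simp
    from sol[OF refl Ff] sol[OF this Fg]
    have "(\<Sum>x\<in>solutions n k a (carrier_vec n). (\<Prod>i\<in>{1..k}. f (x i)) + (\<Prod>i\<in>{1..k}. 1 - f (x i)))
        = real (CARD('a) ^ n) ^ (k - 1) * (2 * (1 / 2) ^ k - \<tau>)"
      unfolding sum.distrib by (simp add: algebra_simps)
    ultimately show "\<exists>f :: 'a vec \<Rightarrow> real. (\<forall>v. 0 \<le> f v \<and> f v \<le> 1) \<and>
      (\<Sum>x\<in>solutions n k a (carrier_vec n). (\<Prod>i\<in>{1..k}. f (x i)) + (\<Prod>i\<in>{1..k}. 1 - f (x i)))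
        = real (CARD('a) ^ n) ^ (k - 1) * (2 * (1 / 2) ^ k - \<tau>)"
      by blast
  qed
qed

end

section \<open>Rounding a fractional colouring\<close>

text \<open>
  A function that is affine in one variable on \<open>[0, 1]\<close> is minimal at an endpoint, so the coordinates can
  be moved to endpoints one after another.
\<close>

lemma round_to_vertex:
  fixes \<Phi> :: "('v \<Rightarrow> real) \<Rightarrow> real"
  assumes "finite U"
    and "\<And>f v. \<Phi> f = (1 - f v) * \<Phi> (f(v := 0)) + f v * \<Phi> (f(v := 1))"
    and "\<And>v. 0 \<le> f v \<and> f v \<le> 1"
  shows "\<exists>g. (\<forall>v\<in>U. g v = 0 \<or> g v = 1) \<and> (\<forall>v. 0 \<le> g v \<and> g v \<le> 1) \<and> \<Phi> g \<le> \<Phi> f"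
  using assms(1)
proof induction
  case empty
  show ?case using assms(3) by auto
next
  case (insert u U)
  then obtain g where g: "\<forall>v\<in>U. g v = 0 \<or> g v = 1" "\<forall>v. 0 \<le> g v \<and> g v \<le> 1" "\<Phi> g \<le> \<Phi> f"
    by blast
  have "\<exists>t\<in>{0, 1}. \<Phi> (g(u := t)) \<le> \<Phi> g"
  proof (rule ccontr)
    assume "\<not> ?thesis"
    then have less: "\<Phi> g < \<Phi> (g(u := 0))" "\<Phi> g < \<Phi> (g(u := 1))" by auto
    have u: "0 \<le> g u" "g u \<le> 1" using g(2) by auto
    have "\<Phi> g = (1 - g u) * \<Phi> g + g u * \<Phi> g" by (simp add: algebra_simps)
    also have "\<dots> < (1 - g u) * \<Phi> (g(u := 0)) + g u * \<Phi> (g(u := 1))"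
    proof (cases "g u = 0")
      case True
      then show ?thesis using less by simp
    next
      case False
      then show ?thesis
        using less u by (intro add_le_less_mono mult_left_mono mult_strict_left_mono) auto
    qed
    also have "\<dots> = \<Phi> g" using assms(2)[of g u] by simp
    finally show False by simp
  qed
  then obtain t where "t \<in> {0, 1}" "\<Phi> (g(u := t)) \<le> \<Phi> g" by blast
  then have "\<Phi> (g(u := t)) \<le> \<Phi> f" "t = 0 \<or> t = 1" using g(3) by auto
  moreover have "\<forall>v\<in>insert u U. (g(u := t)) v = 0 \<or> (g(u := t)) v = 1"
    "\<forall>v. 0 \<le> (g(u := t)) v \<and> (g(u := t)) v \<le> 1"
    using g(1,2) calculation(2) by auto
  ultimately show ?case by blast
qed

text \<open>
  By injectivity, the value of \<open>f\<close> at \<open>v\<close> enters at most one factor of the product.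
\<close>

lemma prod_affine_in_coordinate:
  fixes f :: "'v \<Rightarrow> real" and h :: "real \<Rightarrow> real"
  assumes "finite I" "inj_on x I" and h: "\<And>t. h t = (1 - t) * h 0 + t * h 1"
  shows "(\<Prod>i\<in>I. h (f (x i)))
    = (1 - f v) * (\<Prod>i\<in>I. h ((f(v := 0)) (x i))) + f v * (\<Prod>i\<in>I. h ((f(v := 1)) (x i)))"
proof (cases "v \<in> x ` I")
  case True
  then obtain j where j: "j \<in> I" "x j = v" by blast
  have other: "x i \<noteq> v" if "i \<in> I - {j}" for i
    using that j assms(2) by (metis DiffE inj_on_contraD insertI1)
  have "(\<Prod>i\<in>I. h ((f(v := t)) (x i))) = h t * (\<Prod>i\<in>I - {j}. h (f (x i)))" for t
    using assms(1) j other by (simp add: prod.remove[of I j])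
  moreover from this[of "f v"] have "(\<Prod>i\<in>I. h (f (x i))) = h (f v) * (\<Prod>i\<in>I - {j}. h (f (x i)))"
    by simp
  ultimately show ?thesis using h[of "f v"] by (simp add: algebra_simps)
next
  case False
  then have "(\<Prod>i\<in>I. h ((f(v := t)) (x i))) = (\<Prod>i\<in>I. h (f (x i)))" for t
    by (intro prod.cong) auto
  then show ?thesis by (simp add: algebra_simps)
qed

text \<open>
  Rounding is applied to the weight of the solutions with distinct entries, where
  \<open>prod_affine_in_coordinate\<close> is available. At a vertex of the cube every monochromatic one among these
  solutions has weight at least \<open>1\<close>.
\<close>

lemma round_solutions:
  fixes a :: "nat \<Rightarrow> 'a::{field,finite}"
  assumes f: "\<And>v. 0 \<le> f v \<and> f v \<le> 1"
  shows "\<exists>c :: 'a vec \<Rightarrow> bool. real (card {x \<in> monochromatic_solutions n k a c. inj_on x {1..k}})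
     \<le> (\<Sum>x\<in>solutions n k a (carrier_vec n). (\<Prod>i\<in>{1..k}. f (x i)) + (\<Prod>i\<in>{1..k}. 1 - f (x i)))"
proof -
  let ?S = "solutions n k a (carrier_vec n)"
  let ?I = "{x \<in> ?S. inj_on x {1..k}}"
  define W :: "('a vec \<Rightarrow> real) \<Rightarrow> (nat \<Rightarrow> 'a vec) \<Rightarrow> real" where
    "W g x = (\<Prod>i\<in>{1..k}. g (x i)) + (\<Prod>i\<in>{1..k}. 1 - g (x i))" for g x
  have fin: "finite ?S" by (rule finite_solutions) simp
  have affine: "(\<Sum>x\<in>?I. W g x)
      = (1 - g v) * (\<Sum>x\<in>?I. W (g(v := 0)) x) + g v * (\<Sum>x\<in>?I. W (g(v := 1)) x)" for g v
  proof -
    have "W g x = (1 - g v) * W (g(v := 0)) x + g v * W (g(v := 1)) x" if "x \<in> ?I" for x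
    proof -
      have inj: "inj_on x {1..k}" using that by simp
      show ?thesis
        using prod_affine_in_coordinate[OF _ inj, of "\<lambda>t. t" g v]
          prod_affine_in_coordinate[OF _ inj, of "\<lambda>t. 1 - t" g v]
        by (simp add: W_def distrib_left del: fun_upd_apply)
    qed
    then show ?thesis by (simp add: sum.distrib sum_distrib_left del: fun_upd_apply)
  qed
  have "\<exists>g. (\<forall>v\<in>carrier_vec n. g v = 0 \<or> g v = 1) \<and> (\<forall>v. 0 \<le> g v \<and> g v \<le> 1)
      \<and> (\<Sum>x\<in>?I. W g x) \<le> (\<Sum>x\<in>?I. W f x)"
    by (rule round_to_vertex[OF finite_carrier_vec, where \<Phi> = "\<lambda>g. \<Sum>x\<in>?I. W g x", OF affine f])
  then obtain g where g: "\<And>v. v \<in> carrier_vec n \<Longrightarrow> g v = 0 \<or> g v = 1"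
      "\<And>v. 0 \<le> g v \<and> g v \<le> 1"
    and le: "(\<Sum>x\<in>?I. W g x) \<le> (\<Sum>x\<in>?I. W f x)"
    by blast
  let ?M = "{x \<in> monochromatic_solutions n k a (\<lambda>v. g v = 1). inj_on x {1..k}}"
  have nonneg: "W h x \<ge> 0" if "\<And>v. 0 \<le> h v \<and> h v \<le> 1" for h x
    unfolding W_def using that by (intro add_nonneg_nonneg prod_nonneg) auto
  have "W g x \<ge> 1" if x: "x \<in> ?M" for x
  proof -
    have S: "x i \<in> carrier_vec n" if "i \<in> {1..k}" for i
      using x that by (auto simp: monochromatic_solutions_def solutions_def PiE_iff)
    have "(\<forall>i\<in>{1..k}. g (x i) = 1) \<or> (\<forall>i\<in>{1..k}. g (x i) \<noteq> 1)"
      using x unfolding monochromatic_solutions_def by blast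
    then have "(\<forall>i\<in>{1..k}. g (x i) = 1) \<or> (\<forall>i\<in>{1..k}. g (x i) = 0)"
      using g(1) S by blast
    then show ?thesis
    proof
      assume *: "\<forall>i\<in>{1..k}. g (x i) = 1"
      have "(\<Prod>i\<in>{1..k}. 1 - g (x i)) \<ge> 0" using g(2) by (intro prod_nonneg) auto
      then show ?thesis using * by (simp add: W_def)
    next
      assume *: "\<forall>i\<in>{1..k}. g (x i) = 0"
      have "(\<Prod>i\<in>{1..k}. g (x i)) \<ge> 0" using g(2) by (intro prod_nonneg) auto
      then show ?thesis using * by (simp add: W_def)
    qed
  qed
  \<comment> \<open>The constant colour of a monochromatic solution makes one of the two products equal to \<open>1\<close>.\<close>
  then have "real (card ?M) \<le> (\<Sum>x\<in>?M. W g x)"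
    using sum_mono[of ?M "\<lambda>_. 1" "W g"] by simp
  also have "\<dots> \<le> (\<Sum>x\<in>?I. W g x)"
    using fin nonneg[OF g(2)] by (intro sum_mono2) (auto simp: monochromatic_solutions_def)
  also note le
  also have "(\<Sum>x\<in>?I. W f x) \<le> (\<Sum>x\<in>?S. W f x)"
    using fin nonneg[OF f] by (intro sum_mono2) auto
  finally show ?thesis unfolding W_def by blast
qed

section \<open>Solutions with coinciding entries\<close>

lemma solutions_coordinate:
  fixes a :: "nat \<Rightarrow> 'a::field"
  assumes "x \<in> solutions n k a A" "A \<subseteq> carrier_vec n" "t < n"
  shows "(\<Sum>i\<in>{1..k}. a i * x i $ t) = 0"
proof -
  have x: "x i \<in> carrier_vec n" if "i \<in> {1..k}" for i
    using assms(1,2) that by (auto simp: solutions_def PiE_iff)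
  have "(\<Sum>i\<in>{1..k}. a i * x i $ t) = linear_form n k a x $ t"
    unfolding linear_form_def using x assms(3)
    by (subst index_finsum_vec) (auto intro!: sum.cong simp: carrier_vecD[OF x])
  then show ?thesis using assms(1,3) by (simp add: solutions_def)
qed

text \<open>
  Under the condition \<open>x i = x j\<close>, a solution is determined by its entries outside a suitable set \<open>D\<close> of two
  indices. If \<open>a i + a j \<noteq> 0\<close>, then \<open>D = {i, j}\<close> works: the equation determines the common entry.
  Otherwise there is a third index \<open>m\<close>, because \<open>{i, j}\<close> alone would be a zero-sum pairing, and
  \<open>D = {j, m}\<close> works: entry \<open>j\<close> is a copy of entry \<open>i\<close>, and the equation determines entry \<open>m\<close>.
\<close>

lemma card_solutions_equal_entries:
  fixes a :: "nat \<Rightarrow> 'a::{field,finite}"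
  assumes nz: "\<forall>i\<in>{1..k}. a i \<noteq> 0" and np: "\<not> zero_sum_pairing k a"
    and ij: "i \<in> {1..k}" "j \<in> {1..k}" "i \<noteq> j"
  shows "card {x \<in> solutions n k a (carrier_vec n). x i = x j} \<le> (CARD('a) ^ n) ^ (k - 2)"
proof -
  let ?E = "{x \<in> solutions n k a (carrier_vec n). x i = x j}"
  \<comment> \<open>Here \<open>d\<close> stands for one coordinate of the difference of two solutions.\<close>
  have "\<exists>D \<subseteq> {1..k}. card D = 2 \<and>
    (\<forall>d :: nat \<Rightarrow> 'a. (\<Sum>l\<in>{1..k}. a l * d l) = 0 \<longrightarrow> d i = d j
      \<longrightarrow> (\<forall>l\<in>{1..k} - D. d l = 0) \<longrightarrow> (\<forall>l\<in>D. d l = 0))"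
  proof (cases "a i + a j = 0")
    case False
    show ?thesis
    proof (intro exI[of _ "{i, j}"] conjI allI impI)
      fix d :: "nat \<Rightarrow> 'a"
      assume d: "(\<Sum>l\<in>{1..k}. a l * d l) = 0" "d i = d j" "\<forall>l\<in>{1..k} - {i, j}. d l = 0"
      have "(\<Sum>l\<in>{1..k}. a l * d l) = (\<Sum>l\<in>{i, j}. a l * d l)"
        using d(3) ij by (intro sum.mono_neutral_right) auto
      also have "\<dots> = (a i + a j) * d i" using ij d(2) by (simp add: distrib_right)
      finally show "\<forall>l\<in>{i, j}. d l = 0" using d False by auto
    qed (use ij in auto)
  next
    case True
    have "\<exists>m\<in>{1..k}. m \<noteq> i \<and> m \<noteq> j"
    proof (rule ccontr)
      assume "\<not> ?thesis"
      then have "{1..k} = {i, j}" using ij by auto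
      then have "partition_on {1..k} {{i, j}}"
        by (simp only:) (simp add: partition_on_def disjoint_def)
      then have "zero_sum_pairing k a"
        unfolding zero_sum_pairing_def using ij(3) True by (intro exI[of _ "{{i, j}}"]) auto
      with np show False ..
    qed
    then obtain m where m: "m \<in> {1..k}" "m \<noteq> i" "m \<noteq> j" by blast
    show ?thesis
    proof (intro exI[of _ "{j, m}"] conjI allI impI)
      fix d :: "nat \<Rightarrow> 'a"
      assume d: "(\<Sum>l\<in>{1..k}. a l * d l) = 0" "d i = d j" "\<forall>l\<in>{1..k} - {j, m}. d l = 0"
      then have j: "d j = 0" using ij m by auto
      then have "(\<Sum>l\<in>{1..k}. a l * d l) = (\<Sum>l\<in>{m}. a l * d l)"
        using d(3) m by (intro sum.mono_neutral_right) auto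
      then show "\<forall>l\<in>{j, m}. d l = 0" using d j m nz by auto
    qed (use ij m in auto)
  qed
  then obtain D where D: "D \<subseteq> {1..k}" "card D = 2"
    and det: "\<forall>d :: nat \<Rightarrow> 'a. (\<Sum>l\<in>{1..k}. a l * d l) = 0 \<longrightarrow> d i = d j
      \<longrightarrow> (\<forall>l\<in>{1..k} - D. d l = 0) \<longrightarrow> (\<forall>l\<in>D. d l = 0)"
    by (elim exE conjE)
  let ?R = "\<lambda>x. restrict x ({1..k} - D)"
  have "inj_on ?R ?E"
  proof (rule inj_onI)
    fix x y assume x: "x \<in> ?E" and y: "y \<in> ?E" and eq: "?R x = ?R y"
    have T: "x \<in> {1..k} \<rightarrow>\<^sub>E carrier_vec n" "y \<in> {1..k} \<rightarrow>\<^sub>E carrier_vec n"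
      using x y by (auto simp: solutions_def)
    have off: "x l = y l" if "l \<in> {1..k} - D" for l
      using fun_cong[OF eq, of l] that by (simp add: restrict_def)
    have on: "x l = y l" if l: "l \<in> D" for l
    proof (rule eq_vecI)
      have dims: "x l \<in> carrier_vec n" "y l \<in> carrier_vec n"
        using T l D(1) by (auto simp: PiE_iff)
      then show "dim_vec (x l) = dim_vec (y l)" by auto
      fix t assume "t < dim_vec (y l)"
      then have t: "t < n" using dims by auto
      have "(\<Sum>l\<in>{1..k}. a l * (x l $ t - y l $ t)) = 0"
        using x y solutions_coordinate[of _ n k a "carrier_vec n" t, OF _ subset_refl t]
        by (simp add: right_diff_distrib sum_subtractf)
      moreover have "x i $ t - y i $ t = x j $ t - y j $ t" using x y by simp
      moreover have "\<forall>l\<in>{1..k} - D. x l $ t - y l $ t = 0"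
      proof
        fix m assume "m \<in> {1..k} - D"
        from off[OF this] show "x m $ t - y m $ t = 0" by simp
      qed
      ultimately have "\<forall>l\<in>D. x l $ t - y l $ t = 0"
        using det[THEN spec[of _ "\<lambda>l. x l $ t - y l $ t"]] by blast
      then show "x l $ t = y l $ t" using l by simp
    qed
    show "x = y"
    proof (rule PiE_ext[OF T])
      fix l assume "l \<in> {1..k}"
      then show "x l = y l" using on off by blast
    qed
  qed
  moreover have "?R ` ?E \<subseteq> ({1..k} - D) \<rightarrow>\<^sub>E carrier_vec n"
    by (auto simp: solutions_def PiE_iff)
  ultimately have "card ?E \<le> card (({1..k} - D) \<rightarrow>\<^sub>E (carrier_vec n :: 'a vec set))"
    by (intro card_inj_on_le finite_PiE) auto
  also have "\<dots> = (CARD('a) ^ n) ^ (k - 2)"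
    using D by (simp add: card_PiE card_carrier_vec card_Diff_subset finite_subset)
  finally show ?thesis .
qed

lemma card_non_injective_solutions:
  fixes a :: "nat \<Rightarrow> 'a::{field,finite}"
  assumes "\<forall>i\<in>{1..k}. a i \<noteq> 0" "\<not> zero_sum_pairing k a"
  shows "card {x \<in> solutions n k a (carrier_vec n). \<not> inj_on x {1..k}} \<le> k\<^sup>2 * (CARD('a) ^ n) ^ (k - 2)"
proof -
  let ?J = "{p \<in> {1..k} \<times> {1..k}. fst p \<noteq> snd p}"
  let ?E = "\<lambda>p. {x \<in> solutions n k a (carrier_vec n). x (fst p) = x (snd p)}"
  have "{x \<in> solutions n k a (carrier_vec n). \<not> inj_on x {1..k}} \<subseteq> (\<Union>p\<in>?J. ?E p)"
    unfolding inj_on_def by fastforce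
  then have "card {x \<in> solutions n k a (carrier_vec n). \<not> inj_on x {1..k}} \<le> card (\<Union>p\<in>?J. ?E p)"
    by (intro card_mono finite_UN_I) (auto intro: finite_subset[OF _ finite_solutions])
  also have "\<dots> \<le> (\<Sum>p\<in>?J. card (?E p))" by (intro card_UN_le) auto
  also have "\<dots> \<le> (\<Sum>p\<in>?J. (CARD('a) ^ n) ^ (k - 2))"
    using assms by (intro sum_mono card_solutions_equal_entries) auto
  also have "\<dots> \<le> k\<^sup>2 * (CARD('a) ^ n) ^ (k - 2)"
  proof -
    have "card ?J \<le> card ({1..k} \<times> {1..k})" by (intro card_mono) auto
    then show ?thesis by (simp add: power2_eq_square)
  qed
  finally show ?thesis .
qed

section \<open>Even length without a zero-sum pairing\<close>

text \<open>
  The fractional colouring gains \<open>\<tau> Q ^ (k - 1)\<close>, where \<open>Q = q\<^sup>n\<close>, and the solutions with a repeated entry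
  cost at most \<open>k\<^sup>2 Q ^ (k - 2)\<close>. So any dimension with \<open>k\<^sup>2 < \<tau> Q\<close> has a colouring below the threshold.
\<close>

lemma (in additive_character) even_unpaired_imp_not_common:
  fixes a :: "nat \<Rightarrow> 'a"
  assumes k: "even k" "k \<ge> 1" and nz: "\<forall>i\<in>{1..k}. a i \<noteq> 0" and np: "\<not> zero_sum_pairing k a"
  shows "\<not> common k a"
proof
  assume common: "common k a"
  have k2: "k \<ge> 2" using k by (cases "k = 1") auto
  obtain \<tau> where \<tau>: "\<tau> > 0"
    and frac: "\<And>n. n \<ge> 1 \<Longrightarrow> \<exists>f :: 'a vec \<Rightarrow> real. (\<forall>v. 0 \<le> f v \<and> f v \<le> 1) \<and>
      (\<Sum>x\<in>solutions n k a (carrier_vec n). (\<Prod>i\<in>{1..k}. f (x i)) + (\<Prod>i\<in>{1..k}. 1 - f (x i)))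
        = real (CARD('a) ^ n) ^ (k - 1) * (2 * (1 / 2) ^ k - \<tau>)"
    using negative_fractional_colouring[OF assms] by blast
  have "card {0, 1 :: 'a} \<le> CARD('a)" by (intro card_mono) auto
  then have "real CARD('a) > 1" by simp
  then obtain m where m: "real (k\<^sup>2) / \<tau> < real CARD('a) ^ m"
    using real_arch_pow by blast
  define n where "n = Suc m"
  define Q where "Q = real (CARD('a) ^ n)"
  have n: "n \<ge> 1" by (simp add: n_def)
  have Q: "Q > 0" by (simp add: Q_def)
  have "real CARD('a) ^ m \<le> Q"
    unfolding Q_def n_def of_nat_power using \<open>real CARD('a) > 1\<close> by (intro power_increasing) auto
  with m have large: "real (k\<^sup>2) < \<tau> * Q"
    using \<tau> by (simp add: pos_divide_less_eq mult.commute) (metis less_le_trans mult.commute mult_le_cancel_left_pos)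
  obtain f :: "'a vec \<Rightarrow> real" where f: "\<And>v. 0 \<le> f v \<and> f v \<le> 1"
    and total: "(\<Sum>x\<in>solutions n k a (carrier_vec n). (\<Prod>i\<in>{1..k}. f (x i)) + (\<Prod>i\<in>{1..k}. 1 - f (x i)))
        = Q ^ (k - 1) * (2 * (1 / 2) ^ k - \<tau>)"
    using frac[OF n] unfolding Q_def by blast
  obtain c :: "'a vec \<Rightarrow> bool"
    where c: "real (card {x \<in> monochromatic_solutions n k a c. inj_on x {1..k}})
      \<le> Q ^ (k - 1) * (2 * (1 / 2) ^ k - \<tau>)"
    using round_solutions[where f = f and n = n and k = k and a = a, OF f] unfolding total by blast
  let ?M = "monochromatic_solutions n k a c"
  let ?N = "{x \<in> solutions n k a (carrier_vec n). \<not> inj_on x {1..k}}"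
  have fin: "finite (solutions n k a (carrier_vec n))" by (rule finite_solutions) simp
  have Qk: "Q ^ (k - 1) = Q * Q ^ (k - 2)"
    using k2 by (metis Suc_diff_le diff_Suc_Suc numeral_2_eq_2 One_nat_def power_Suc)
  have "card ?M \<le> card ({x \<in> ?M. inj_on x {1..k}} \<union> ?N)"
    using fin by (intro card_mono) (auto simp: monochromatic_solutions_def)
  also have "\<dots> \<le> card {x \<in> ?M. inj_on x {1..k}} + card ?N" by (rule card_Un_le)
  finally have "real (card ?M) \<le> real (card {x \<in> ?M. inj_on x {1..k}}) + real (card ?N)"
    by linarith
  also have "\<dots> \<le> Q ^ (k - 1) * (2 * (1 / 2) ^ k - \<tau>) + real (k\<^sup>2) * Q ^ (k - 2)"
  proof (rule add_mono[OF c])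
    have "real (card ?N) \<le> real (k\<^sup>2 * (CARD('a) ^ n) ^ (k - 2))"
      using card_non_injective_solutions[OF nz np, of n] by (simp only: of_nat_le_iff)
    then show "real (card ?N) \<le> real (k\<^sup>2) * Q ^ (k - 2)" by (simp add: Q_def)
  qed
  also have "\<dots> < Q ^ (k - 1) * (2 * (1 / 2) ^ k - \<tau>) + (\<tau> * Q) * Q ^ (k - 2)"
    using large Q by (intro add_strict_left_mono mult_strict_right_mono) auto
  also have "\<dots> = 2 * (Q / 2) ^ k / Q"
  proof -
    have "Q ^ k = Q * Q ^ (k - 1)" using k(2) by (cases k) auto
    then show ?thesis using Q by (simp add: Qk power_divide algebra_simps del: One_nat_def)
  qed
  also have "\<dots> = 2 powi (1 - int k) * Q ^ (k - 1)"
    by (rule common_threshold[OF k(2) Q, symmetric])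
  also have "\<dots> = 2 powi (1 - int k) * real CARD('a) ^ (n * (k - 1))"
    by (simp add: Q_def power_mult)
  finally show False using common n unfolding common_def by (meson not_le)
qed

theorem theorem1p4:
  fixes k :: nat and a :: "nat \<Rightarrow> 'a::{field,finite}"
  assumes "k \<ge> 1"
    and "\<forall>i\<in>{1..k}. a i \<noteq> 0"
  shows "(zero_sum_pairing k a \<longrightarrow> sidorenko k a \<and> common k a) \<and>
    (even k \<and> \<not> zero_sum_pairing k a \<longrightarrow> \<not> common k a \<and> \<not> sidorenko k a) \<and>
    (odd k \<longrightarrow> common k a \<and> \<not> sidorenko k a)"
proof -
  obtain \<psi> :: "'a \<Rightarrow> complex" where "additive_character \<psi>"
    using nontrivial_additive_character_exists unfolding additive_character_def by blast
  then interpret additive_character \<psi> .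
  show ?thesis
    using assms pairing_imp_sidorenko[of k a] even_unpaired_imp_not_common[of k a]
      odd_imp_common[of k a] odd_imp_not_sidorenko[of k a] sidorenko_imp_common[of k a]
    by blast
qed

end
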